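(* There is a deterministic algorithm which, given an integer $n\ge1$, a prime $p$, and a set $S\subseteq\mathbb{Z}_p^n$ with $\mathbf{0}\in S$ and $1000<|S|<p<\frac{4|S|}{3}$, where $S$ is accessed only by iterating over its elements, outputs $\mathbf{a}\in\mathbb{Z}_p^n$ satisfying (1) $|\{\mathbf{y}\in S:\langle\mathbf{y},\mathbf{a}\rangle\equiv0\pmod p\}|\le6$ and (2) $|\{\langle\mathbf{y},\mathbf{a}\rangle\bmod p:\mathbf{y}\in S\}|\ge\frac{p+2}{3}$. The algorithm performs $\mathrm{poly}(n,\log p)\,p^4$ arithmetic operations and $O(np^3)$ iterations over the elements of $S$, and, not counting the space needed to iterate over $S$, uses $\mathrm{poly}(n,\log p)$ space.
   Context: $\mathbb{Z}_p$ denotes the integers modulo $p$ and $\langle\cdot,\cdot\rangle$ the standard bilinear form on $\mathbb{Z}_p^n$. *)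

theory Defs
  imports
    "Jordan_Normal_Form.Matrix"
    "HOL-Computational_Algebra.Polynomial"
    "HOL-Computational_Algebra.Primes"
    "HOL-Number_Theory.Cong"
    "HOL-Library.Log_Nat"
begin

(* The integers modulo p are represented by their residues 0, ..., p - 1 in nat.  The bilinear
   form is the integer scalar product of representatives; only its residue modulo p is used. *)

definition Zp_vecs :: "nat \<Rightarrow> nat \<Rightarrow> nat vec set" where
  "Zp_vecs n p = {v \<in> carrier_vec n. \<forall>i<n. v $ i < p}"

(* A program is a finite command over registers (statically addressed, so only finitely many occur
   in any program) and an indirectly addressed memory; all cells hold natural numbers.  The set S
   is reachable only through ForEach, which runs its body once for each element of S, and Coord,
   which reads a coordinate of the element currently visited by the innermost enclosing ForEach.
   There is no way to test membership in S, to index into S, or to write to it. *)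

datatype arith = Add | Sub | Mul | Div | Mod

datatype instr =
    Const nat nat            (* reg r := k *)
  | Arith nat arith nat nat  (* reg r := reg i op reg j *)
  | Load nat nat             (* reg r := mem (reg i) *)
  | Store nat nat            (* mem (reg i) := reg j *)
  | Coord nat nat            (* reg r := coordinate number (reg i) of the current element *)

datatype com =
    Instr instr
  | Seq com com
  | IfNZ nat com com
  | WhileNZ nat com
  | ForEach com

record state =
  reg :: "nat \<Rightarrow> nat"
  mem :: "nat \<Rightarrow> nat"

(* Sub is truncated subtraction, and Div and Mod by 0 are as in the library. *)
fun arith_op :: "arith \<Rightarrow> nat \<Rightarrow> nat \<Rightarrow> nat" where
  "arith_op Add a b = a + b"
| "arith_op Sub a b = a - b"
| "arith_op Mul a b = a * b"
| "arith_op Div a b = a div b"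
| "arith_op Mod a b = a mod b"

definition coord :: "nat vec \<Rightarrow> nat \<Rightarrow> nat" where
  "coord y i = (if i < dim_vec y then y $ i else 0)"

fun effect :: "nat vec \<Rightarrow> instr \<Rightarrow> state \<Rightarrow> state" where
  "effect y (Const r k) s = s\<lparr>reg := (reg s)(r := k)\<rparr>"
| "effect y (Arith r f i j) s = s\<lparr>reg := (reg s)(r := arith_op f (reg s i) (reg s j))\<rparr>"
| "effect y (Load r i) s = s\<lparr>reg := (reg s)(r := mem s (reg s i))\<rparr>"
| "effect y (Store i j) s = s\<lparr>mem := (mem s)(reg s i := reg s j)\<rparr>"
| "effect y (Coord r i) s = s\<lparr>reg := (reg s)(r := coord y (reg s i))\<rparr>"

(* Space is measured in bits: every nonzero cell is charged for its address and its content, so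
   neither huge numbers nor huge addresses are free.  The sums are finite in every reachable state,
   see exec_finite_state. *)

definition bits :: "(nat \<Rightarrow> nat) \<Rightarrow> nat" where
  "bits f = (\<Sum>i | f i \<noteq> 0. floorlog 2 i + floorlog 2 (f i))"

definition space :: "state \<Rightarrow> nat" where
  "space s = bits (reg s) + bits (mem s)"

(* exec xs y c s t q m s':  with xs enumerating S and y the current element, c started in s
   terminates in s' after t steps and q iterations over the whole of xs, and m is the maximal
   space of a state occurring on the way.  Every instruction, every test and every visit of an
   element is a step, so t bounds the number of arithmetic operations.  ForEach loops may be
   nested; each execution of an inner loop is charged as an iteration of its own.
   iter xs zs c s t q m s':  the same for running the body c on the remaining elements zs of a
   ForEach loop. *)

inductive
  exec :: "nat vec list \<Rightarrow> nat vec \<Rightarrow> com \<Rightarrow> state \<Rightarrow> nat \<Rightarrow> nat \<Rightarrow> nat \<Rightarrow> state \<Rightarrow> bool" and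
  iter :: "nat vec list \<Rightarrow> nat vec list \<Rightarrow> com \<Rightarrow> state \<Rightarrow> nat \<Rightarrow> nat \<Rightarrow> nat \<Rightarrow> state \<Rightarrow> bool"
  for xs where
  Instr: "exec xs y (Instr a) s 1 0 (max (space s) (space (effect y a s))) (effect y a s)"
| Seq: "exec xs y c s t q m s' \<Longrightarrow> exec xs y d s' t' q' m' s'' \<Longrightarrow>
    exec xs y (Seq c d) s (t + t') (q + q') (max m m') s''"
| IfTrue: "reg s r \<noteq> 0 \<Longrightarrow> exec xs y c s t q m s' \<Longrightarrow>
    exec xs y (IfNZ r c d) s (1 + t) q m s'"
| IfFalse: "reg s r = 0 \<Longrightarrow> exec xs y d s t q m s' \<Longrightarrow>
    exec xs y (IfNZ r c d) s (1 + t) q m s'"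
| WhileFalse: "reg s r = 0 \<Longrightarrow> exec xs y (WhileNZ r c) s 1 0 (space s) s"
| WhileTrue: "reg s r \<noteq> 0 \<Longrightarrow> exec xs y c s t q m s' \<Longrightarrow>
    exec xs y (WhileNZ r c) s' t' q' m' s'' \<Longrightarrow>
    exec xs y (WhileNZ r c) s (1 + t + t') (q + q') (max m m') s''"
| ForEach: "iter xs xs c s t q m s' \<Longrightarrow> exec xs y (ForEach c) s (1 + t) (1 + q) m s'"
| IterNil: "iter xs [] c s 0 0 (space s) s"
| IterCons: "exec xs z c s t q m s' \<Longrightarrow> iter xs zs c s' t' q' m' s'' \<Longrightarrow>
    iter xs (z # zs) c s (1 + t + t') (q + q') (max m m') s''"

lemma exec_iter_deterministic:
  "exec xs y c s t q m s' \<Longrightarrow>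
    exec xs y c s t2 q2 m2 s2 \<Longrightarrow> t2 = t \<and> q2 = q \<and> m2 = m \<and> s2 = s'"
  "iter xs zs c s t q m s' \<Longrightarrow>
    iter xs zs c s t2 q2 m2 s2 \<Longrightarrow> t2 = t \<and> q2 = q \<and> m2 = m \<and> s2 = s'"
proof (induction arbitrary: t2 q2 m2 s2 and t2 q2 m2 s2 rule: exec_iter.inducts)
  case (Instr y a s)
  then show ?case by (auto elim: exec.cases)
next
  case (Seq y c s t q m s' d t' q' m' s'')
  from Seq.prems show ?case by (cases rule: exec.cases) (use Seq.IH in blast)+
next
  case (IfTrue s r y c t q m s' d)
  from IfTrue.prems IfTrue.hyps show ?case by (cases rule: exec.cases) (use IfTrue.IH in blast)+
next
  case (IfFalse s r y d t q m s' c)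
  from IfFalse.prems IfFalse.hyps show ?case by (cases rule: exec.cases) (use IfFalse.IH in blast)+
next
  case (WhileFalse s r y c)
  from WhileFalse.prems WhileFalse.hyps show ?case by (cases rule: exec.cases) auto
next
  case (WhileTrue s r y c t q m s' t' q' m' s'')
  from WhileTrue.prems WhileTrue.hyps show ?case
    by (cases rule: exec.cases) (use WhileTrue.IH in blast)+
next
  case (ForEach c s t q m s' y)
  from ForEach.prems show ?case by (cases rule: exec.cases) (use ForEach.IH in blast)+
next
  case (IterNil c s)
  from IterNil.prems show ?case by (cases rule: iter.cases) auto
next
  case (IterCons z c s t q m s' zs t' q' m' s'')
  from IterCons.prems show ?case by (cases rule: iter.cases) (use IterCons.IH in blast)+
qed

definition finite_state :: "state \<Rightarrow> bool" where
  "finite_state s \<longleftrightarrow> finite {i. reg s i \<noteq> 0} \<and> finite {i. mem s i \<noteq> 0}"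

lemma finite_support_upd:
  fixes f :: "nat \<Rightarrow> nat"
  assumes "finite {i. f i \<noteq> 0}"
  shows "finite {i. (f(k := v)) i \<noteq> 0}"
  by (rule finite_subset[of _ "insert k {i. f i \<noteq> 0}"]) (use assms in auto)

lemma effect_finite_state: "finite_state s \<Longrightarrow> finite_state (effect y a s)"
  unfolding finite_state_def
  by (cases a) (auto simp del: fun_upd_apply neq0_conv bot_nat_0.not_eq_extremum intro: finite_support_upd)

lemma exec_finite_state:
  "exec xs y c s t q m s' \<Longrightarrow> finite_state s \<Longrightarrow> finite_state s'"
  "iter xs zs c s t q m s' \<Longrightarrow> finite_state s \<Longrightarrow> finite_state s'"
  by (induction rule: exec_iter.inducts) (auto simp: effect_finite_state)

(* n and p are given in registers 0 and 1; the output is read off memory cells 0, ..., n - 1. *)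

definition init :: "nat \<Rightarrow> nat \<Rightarrow> state" where
  "init n p = \<lparr>reg = (\<lambda>_. 0)(0 := n, 1 := p), mem = (\<lambda>_. 0)\<rparr>"

definition result_vec :: "nat \<Rightarrow> state \<Rightarrow> nat vec" where
  "result_vec n s = vec n (mem s)"

(* runs P n p xs t q m a:  on input n, p and the set enumerated by xs, the program P halts with
   output a.  Outside of all ForEach loops there is no current element; Coord then reads 0. *)
definition runs ::
  "com \<Rightarrow> nat \<Rightarrow> nat \<Rightarrow> nat vec list \<Rightarrow> nat \<Rightarrow> nat \<Rightarrow> nat \<Rightarrow> nat vec \<Rightarrow> bool" where
  "runs P n p xs t q m a \<longleftrightarrow> (\<exists>s. exec xs vNil P (init n p) t q m s \<and> a = result_vec n s)"

lemma init_finite_state: "finite_state (init n p)"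
  unfolding finite_state_def init_def
  by (auto simp del: fun_upd_apply neq0_conv bot_nat_0.not_eq_extremum intro!: finite_support_upd)

lemma runs_deterministic:
  "runs P n p xs t q m a \<Longrightarrow> runs P n p xs t' q' m' a' \<Longrightarrow> t' = t \<and> q' = q \<and> m' = m \<and> a' = a"
  unfolding runs_def by (metis exec_iter_deterministic(1))

(* A bivariate real polynomial, evaluated at n and log p. *)
definition poly_n_logp :: "real poly poly \<Rightarrow> nat \<Rightarrow> nat \<Rightarrow> real" where
  "poly_n_logp Q n p = poly (poly Q [:real n:]) (log 2 (real p))"

end

theory Submission
  imports Defs
begin

text \<open>
  The entries of \<open>a\<close> are fixed from the last to the first by the method of conditional expectations.
  For distinct \<open>y\<close> and \<open>z\<close> whose first differing coordinate is \<open>i\<close>, the event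
  \<open>\<langle>y, a\<rangle> = \<langle>z, a\<rangle>\<close> is decided when \<open>a i\<close> is chosen, and exactly one of the \<open>p\<close> values of \<open>a i\<close>
  makes it true.  So it suffices to choose at stage \<open>i\<close> the value of \<open>a i\<close> that minimises the
  (weighted) number of collisions among the pairs that agree below \<open>i\<close>; this takes two nested loops
  over \<open>S\<close> for each of the \<open>n * p\<close> candidates.  With \<open>s = card S\<close>, \<open>N\<close> the number of zeros and \<open>M\<close> the
  number of ordered pairs with equal values, diagonal included, the final vector satisfies
  \<open>p * (2 * M + s * N) \<le> 3 * s * (p + s - 1)\<close>.  Since \<open>M \<ge> s\<close>, this bounds \<open>N\<close>; since \<open>N \<ge> 1\<close>, it
  bounds \<open>M\<close>, and by Cauchy--Schwarz there are at least \<open>s\<^sup>2 / M\<close> values.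
\<close>

section \<open>Resource-bounded weakest preconditions\<close>

text \<open>There is no empty command, so the empty list gets a placeholder that overwrites register
  0; \<open>wp_block\<close> therefore asks for a nonempty list.\<close>

fun block :: "instr list \<Rightarrow> com" where
  "block [] = Instr (Const 0 0)"
| "block [a] = Instr a"
| "block (a # b # as) = Seq (Instr a) (block (b # as))"

lemma floorlog_le_self: "floorlog 2 i \<le> i"
proof (cases "i = 0")
  case False
  have "i < 2 ^ i" by simp
  then show ?thesis by (simp add: floorlog_leI)
qed (simp add: floorlog_def)

text \<open>At most \<open>K\<close> cells are nonzero, and each pays at most \<open>K\<close> for
  its address and \<open>floorlog 2 B\<close> for its content. The crude address bound is affordable
  because \<open>K\<close> will be 19 or \<open>2 * n\<close>.\<close>

lemma bits_le:
  assumes "\<And>i. f i \<le> B" "\<And>i. i \<ge> K \<Longrightarrow> f i = 0"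
  shows "bits f \<le> K * (K + floorlog 2 B)"
proof -
  have sub: "{i. f i \<noteq> 0} \<subseteq> {..<K}"
    using assms(2) by (auto simp del: neq0_conv intro: ccontr)
  have "bits f \<le> (\<Sum>i | f i \<noteq> 0. K + floorlog 2 B)"
    unfolding bits_def
  proof (intro sum_mono add_mono)
    fix i assume "i \<in> {i. f i \<noteq> 0}"
    with sub have "i < K" by auto
    then show "floorlog 2 i \<le> K" using floorlog_le_self[of i] by simp
    show "floorlog 2 (f i) \<le> floorlog 2 B" by (rule floorlog_mono) (rule assms)
  qed
  also have "\<dots> = card {i. f i \<noteq> 0} * (K + floorlog 2 B)" by simp
  also have "\<dots> \<le> K * (K + floorlog 2 B)"
    using card_mono[OF _ sub] by (intro mult_right_mono) auto
  finally show ?thesis .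
qed

locale machine =
  fixes xs :: "nat vec list" and K L B :: nat
begin

text \<open>Keeping this invariant in every state bounds the space by one number, so no rule below
  has to track space step by step.\<close>

definition ok :: "state \<Rightarrow> bool" where
  "ok s \<longleftrightarrow> (\<forall>r. reg s r \<le> B) \<and> (\<forall>r\<ge>K. reg s r = 0) \<and>
    (\<forall>i. mem s i \<le> B) \<and> (\<forall>i\<ge>L. mem s i = 0)"

definition space_bound :: nat where
  "space_bound = K * (K + floorlog 2 B) + L * (L + floorlog 2 B)"

lemma space_ok: "ok s \<Longrightarrow> space s \<le> space_bound"
  unfolding ok_def space_def space_bound_def by (intro add_mono bits_le) auto

text \<open>\<open>Load\<close> and \<open>Store\<close> carry no condition on the value moved:
  under \<open>ok\<close> it is at most \<open>B\<close> already.\<close>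

fun fits :: "nat vec \<Rightarrow> instr \<Rightarrow> state \<Rightarrow> bool" where
  "fits y (Const r k) s \<longleftrightarrow> r < K \<and> k \<le> B"
| "fits y (Arith r f i j) s \<longleftrightarrow> r < K \<and> arith_op f (reg s i) (reg s j) \<le> B"
| "fits y (Load r i) s \<longleftrightarrow> r < K"
| "fits y (Store i j) s \<longleftrightarrow> reg s i < L"
| "fits y (Coord r i) s \<longleftrightarrow> r < K \<and> coord y (reg s i) \<le> B"

lemma ok_effect: "ok s \<Longrightarrow> fits y a s \<Longrightarrow> ok (effect y a s)"
  by (cases a) (auto simp: ok_def)

fun all_fit :: "nat vec \<Rightarrow> instr list \<Rightarrow> state \<Rightarrow> bool" where
  "all_fit y [] s \<longleftrightarrow> True"
| "all_fit y (a # as) s \<longleftrightarrow> fits y a s \<and> all_fit y as (effect y a s)"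

text \<open>Total correctness: termination is included, \<open>t\<close> and \<open>q\<close> are
  upper bounds, and \<open>ok\<close> is an implicit part of both precondition and
  postcondition.\<close>

definition wp ::
  "nat vec \<Rightarrow> com \<Rightarrow> nat \<Rightarrow> nat \<Rightarrow> (state \<Rightarrow> bool) \<Rightarrow> state \<Rightarrow> bool" where
  "wp y c t q Q s \<longleftrightarrow> (ok s \<longrightarrow> (\<exists>t' q' m s'. exec xs y c s t' q' m s' \<and>
    t' \<le> t \<and> q' \<le> q \<and> m \<le> space_bound \<and> ok s' \<and> Q s'))"

lemma wp_mono:
  "wp y c t q Q s \<Longrightarrow> t \<le> t' \<Longrightarrow> q \<le> q' \<Longrightarrow> (\<And>s. ok s \<Longrightarrow> Q s \<Longrightarrow> Q' s) \<Longrightarrow> wp y c t' q' Q' s"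
  unfolding wp_def by (meson order_trans)

lemma wp_instr:
  assumes "fits y a s" "Q (effect y a s)"
  shows "wp y (Instr a) 1 0 Q s"
  unfolding wp_def
proof
  assume "ok s"
  then have "ok (effect y a s)" using assms(1) by (rule ok_effect)
  with \<open>ok s\<close> show "\<exists>t' q' m s'. exec xs y (Instr a) s t' q' m s' \<and>
      t' \<le> 1 \<and> q' \<le> 0 \<and> m \<le> space_bound \<and> ok s' \<and> Q s'"
    using exec_iter.Instr[of xs y a s] assms(2) space_ok
    by (meson le_refl max.boundedI)
qed

lemma wp_seq:
  assumes "wp y c t q R s" "\<And>s'. ok s' \<Longrightarrow> R s' \<Longrightarrow> wp y d t' q' Q s'"
    and "t + t' \<le> T" "q + q' \<le> C"
  shows "wp y (Seq c d) T C Q s"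
  unfolding wp_def
proof
  assume "ok s"
  with assms(1) obtain t1 q1 m1 s1 where 1: "exec xs y c s t1 q1 m1 s1"
    "t1 \<le> t" "q1 \<le> q" "m1 \<le> space_bound" "ok s1" "R s1"
    unfolding wp_def by blast
  with assms(2) obtain t2 q2 m2 s2 where 2: "exec xs y d s1 t2 q2 m2 s2"
    "t2 \<le> t'" "q2 \<le> q'" "m2 \<le> space_bound" "ok s2" "Q s2"
    unfolding wp_def by blast
  show "\<exists>u r m s'. exec xs y (Seq c d) s u r m s' \<and>
      u \<le> T \<and> r \<le> C \<and> m \<le> space_bound \<and> ok s' \<and> Q s'"
    by (rule exI, rule exI, rule exI, rule exI, rule conjI, rule exec_iter.Seq[OF 1(1) 2(1)])
      (use 1 2 assms(3,4) in auto)
qed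

lemma wp_block_exact:
  assumes "as \<noteq> []" "all_fit y as s" "Q (fold (effect y) as s)"
  shows "wp y (block as) (length as) 0 Q s"
  using assms
proof (induction as arbitrary: s rule: block.induct)
  case (2 a)
  then show ?case using wp_instr[of y a s Q] by simp
next
  case (3 a b as)
  have "wp y (Seq (Instr a) (block (b # as))) (1 + length (b # as)) (0 + 0) Q s"
  proof (rule wp_seq)
    show "wp y (Instr a) 1 0 (\<lambda>s'. s' = effect y a s) s"
      using 3 by (intro wp_instr) auto
  next
    fix s' assume "s' = effect y a s"
    then show "wp y (block (b # as)) (length (b # as)) 0 Q s'" using 3 by auto
  qed auto
  then show ?case by simp
qed simp

lemma wp_block:
  assumes "as \<noteq> []" "ok s \<Longrightarrow> all_fit y as s" "ok s \<Longrightarrow> Q (fold (effect y) as s)"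
    and "length as \<le> t"
  shows "wp y (block as) t q Q s"
  using wp_mono[OF wp_block_exact[of as y s Q], of t q Q] assms by (auto simp: wp_def)

lemma wp_if:
  assumes "reg s r \<noteq> 0 \<Longrightarrow> wp y c t q Q s" "reg s r = 0 \<Longrightarrow> wp y d t q Q s"
    and "1 + t \<le> T"
  shows "wp y (IfNZ r c d) T q Q s"
  unfolding wp_def
proof
  assume ok: "ok s"
  show "\<exists>t' q' m s'. exec xs y (IfNZ r c d) s t' q' m s' \<and>
      t' \<le> T \<and> q' \<le> q \<and> m \<le> space_bound \<and> ok s' \<and> Q s'"
  proof (cases "reg s r = 0")
    case True
    with assms(2) ok obtain t1 q1 m1 s1 where 1: "exec xs y d s t1 q1 m1 s1"
      "t1 \<le> t" "q1 \<le> q" "m1 \<le> space_bound" "ok s1" "Q s1"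
      unfolding wp_def by blast
    show ?thesis
      by (rule exI, rule exI, rule exI, rule exI, rule conjI,
          rule exec_iter.IfFalse[OF True 1(1)]) (use 1 assms(3) in auto)
  next
    case False
    with assms(1) ok obtain t1 q1 m1 s1 where 1: "exec xs y c s t1 q1 m1 s1"
      "t1 \<le> t" "q1 \<le> q" "m1 \<le> space_bound" "ok s1" "Q s1"
      unfolding wp_def by blast
    show ?thesis
      by (rule exI, rule exI, rule exI, rule exI, rule conjI,
          rule exec_iter.IfTrue[OF False 1(1)]) (use 1 assms(3) in auto)
  qed
qed

text \<open>The loop register doubles as the variant: it counts down from \<open>N\<close>, and the
  invariant is indexed by its value.\<close>

lemma wp_while:
  assumes "reg s r = N" "I N s"
    and step: "\<And>k s. k < N \<Longrightarrow> ok s \<Longrightarrow> reg s r = Suc k \<Longrightarrow> I (Suc k) s \<Longrightarrow>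
      wp y c t q (\<lambda>s'. reg s' r = k \<and> I k s') s"
    and "1 + N * (1 + t) \<le> T" "N * q \<le> C"
  shows "wp y (WhileNZ r c) T C (I 0) s"
proof -
  have "wp y (WhileNZ r c) (1 + k * (1 + t)) (k * q) (I 0) s"
    if "k \<le> N" "reg s r = k" "I k s" for k s
    using that
  proof (induction k arbitrary: s)
    case 0
    then show ?case unfolding wp_def
      using exec_iter.WhileFalse[of s r xs y c] space_ok by fastforce
  next
    case (Suc k)
    show ?case unfolding wp_def
    proof
      assume "ok s"
      with step[of k s] Suc.prems obtain t1 q1 m1 s1 where 1: "exec xs y c s t1 q1 m1 s1"
        "t1 \<le> t" "q1 \<le> q" "m1 \<le> space_bound" "ok s1" "reg s1 r = k" "I k s1"
        unfolding wp_def by (metis Suc_le_eq)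
      with Suc.IH[of s1] Suc.prems obtain t2 q2 m2 s2 where
        2: "exec xs y (WhileNZ r c) s1 t2 q2 m2 s2"
        "t2 \<le> 1 + k * (1 + t)" "q2 \<le> k * q" "m2 \<le> space_bound" "ok s2" "I 0 s2"
        unfolding wp_def by (metis Suc_leD)
      from Suc.prems have nz: "reg s r \<noteq> 0" by simp
      show "\<exists>u v m s'. exec xs y (WhileNZ r c) s u v m s' \<and> u \<le> 1 + Suc k * (1 + t) \<and>
          v \<le> Suc k * q \<and> m \<le> space_bound \<and> ok s' \<and> I 0 s'"
        by (rule exI, rule exI, rule exI, rule exI, rule conjI,
            rule exec_iter.WhileTrue[OF nz 1(1) 2(1)]) (use 1 2 in auto)
    qed
  qed
  from wp_mono[OF this[OF order_refl assms(1,2)] assms(4,5)] show ?thesis by blast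
qed

text \<open>The invariant is indexed by the prefix of \<open>xs\<close> visited so far. The leading
  1 in the iteration count pays for this loop itself, the product for the loops nested in its
  body.\<close>

lemma wp_foreach:
  assumes "I [] s"
    and step: "\<And>ys z zs s. xs = ys @ z # zs \<Longrightarrow> ok s \<Longrightarrow> I ys s \<Longrightarrow> wp z c t q (I (ys @ [z])) s"
    and T: "1 + length xs * (1 + t) \<le> T" "1 + length xs * q \<le> C"
  shows "wp y (ForEach c) T C (I xs) s"
proof -
  have iter: "\<exists>t' q' m s'. iter xs zs c s t' q' m s' \<and>
      t' \<le> length zs * (1 + t) \<and> q' \<le> length zs * q \<and> m \<le> space_bound \<and> ok s' \<and> I xs s'"
    if "xs = ys @ zs" "ok s" "I ys s" for ys zs s
    using that
  proof (induction zs arbitrary: ys s)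
    case Nil
    then show ?case using exec_iter.IterNil[of xs c s] space_ok by fastforce
  next
    case (Cons z zs)
    from step[OF Cons.prems(1) Cons.prems(2) Cons.prems(3)] Cons.prems(2)
    obtain t1 q1 m1 s1 where 1: "exec xs z c s t1 q1 m1 s1"
      "t1 \<le> t" "q1 \<le> q" "m1 \<le> space_bound" "ok s1" "I (ys @ [z]) s1"
      unfolding wp_def by blast
    from Cons.IH[of "ys @ [z]" s1] 1 Cons.prems obtain t2 q2 m2 s2 where
      2: "iter xs zs c s1 t2 q2 m2 s2" "t2 \<le> length zs * (1 + t)" "q2 \<le> length zs * q"
      "m2 \<le> space_bound" "ok s2" "I xs s2"
      by auto
    show ?case
      by (rule exI, rule exI, rule exI, rule exI, rule conjI,
          rule exec_iter.IterCons[OF 1(1) 2(1)]) (use 1 2 in auto)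
  qed
  show ?thesis unfolding wp_def
  proof
    assume "ok s"
    with iter[of "[]" xs s] assms(1) obtain t2 q2 m2 s2 where
      2: "iter xs xs c s t2 q2 m2 s2" "t2 \<le> length xs * (1 + t)" "q2 \<le> length xs * q"
      "m2 \<le> space_bound" "ok s2" "I xs s2"
      by auto
    show "\<exists>t' q' m s'. exec xs y (ForEach c) s t' q' m s' \<and> t' \<le> T \<and> q' \<le> C \<and> m \<le> space_bound \<and> ok s' \<and> I xs s'"
      by (rule exI, rule exI, rule exI, rule exI, rule conjI,
          rule exec_iter.ForEach[OF 2(1)]) (use 2 T in auto)
  qed
qed

end

section \<open>The potential\<close>

definition ip :: "nat \<Rightarrow> (nat \<Rightarrow> nat) \<Rightarrow> (nat \<Rightarrow> nat) \<Rightarrow> nat" where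
  "ip n y a = (\<Sum>j<n. y j * a j)"

definition agree :: "nat \<Rightarrow> (nat \<Rightarrow> nat) \<Rightarrow> (nat \<Rightarrow> nat) \<Rightarrow> bool" where
  "agree i y z \<longleftrightarrow> (\<forall>j<i. y j = z j)"

text \<open>Agreement below \<open>i\<close> makes \<open>a 0, ..., a (i - 1)\<close> contribute
  equally to both products, so the congruence depends only on the entries from \<open>i\<close> on.
  With functions in place of vectors, choosing an entry is a function update and the zero vector is
  \<open>\<lambda>_. 0\<close>.\<close>

definition collide ::
  "nat \<Rightarrow> nat \<Rightarrow> nat \<Rightarrow> (nat \<Rightarrow> nat) \<Rightarrow> (nat \<Rightarrow> nat) \<Rightarrow> (nat \<Rightarrow> nat) \<Rightarrow> bool" where
  "collide n p i a y z \<longleftrightarrow> agree i y z \<and> [ip n y a = ip n z a] (mod p)"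

text \<open>For uniformly random \<open>a 0, \<dots>, a (i - 1)\<close> and \<open>y \<noteq> z\<close> this is \<open>p\<close> times the
  probability that \<open>y\<close> and \<open>z\<close> get the same value, given \<open>a i, \<dots>, a (n - 1)\<close>.\<close>

definition pot ::
  "nat \<Rightarrow> nat \<Rightarrow> nat \<Rightarrow> (nat \<Rightarrow> nat) \<Rightarrow> (nat \<Rightarrow> nat) \<Rightarrow> (nat \<Rightarrow> nat) \<Rightarrow> nat" where
  "pot n p i a y z = p * of_bool (collide n p i a y z) + of_bool (\<not> agree i y z)"

lemma ip_upd:
  assumes "i < n"
  shows "ip n y (a(i := v)) = y i * v + (\<Sum>j\<in>{..<n} - {i}. y j * a j)"
proof -
  have "ip n y (a(i := v)) = y i * v + (\<Sum>j\<in>{..<n} - {i}. y j * (a(i := v)) j)"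
    unfolding ip_def using assms by (subst sum.remove[of _ i]) auto
  also have "(\<Sum>j\<in>{..<n} - {i}. y j * (a(i := v)) j) = (\<Sum>j\<in>{..<n} - {i}. y j * a j)"
    by (rule sum.cong) auto
  finally show ?thesis .
qed

text \<open>The difference of the two products is affine in the entry at \<open>i\<close>, with
  slope \<open>y i - z i\<close>, which is invertible modulo \<open>p\<close>; hence it has at most
  one root among the residues.\<close>

lemma collide_upd_unique:
  assumes "prime p" "i < n" "y i < p" "z i < p" "y i \<noteq> z i" "v < p" "w < p"
    and "collide n p i (a(i := v)) y z" "collide n p i (a(i := w)) y z"
  shows "v = w"
proof -
  define Y where "Y = int (\<Sum>j\<in>{..<n} - {i}. y j * a j)"
  define Z where "Z = int (\<Sum>j\<in>{..<n} - {i}. z j * a j)"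
  have *: "int p dvd (int (y i) - int (z i)) * int u + (Y - Z)"
    if "collide n p i (a(i := u)) y z" for u
  proof -
    from that have "[int (y i * u) + Y = int (z i * u) + Z] (mod int p)"
      unfolding collide_def ip_upd[OF assms(2)] Y_def Z_def
      by (simp only: cong_int_iff flip: of_nat_add)
    then show ?thesis by (simp add: cong_iff_dvd_diff algebra_simps)
  qed
  have "int p dvd (int (y i) - int (z i)) * (int v - int w)"
    using dvd_diff[OF *[OF assms(8)] *[OF assms(9)]] by (simp add: algebra_simps)
  moreover have "prime (int p)" using assms(1) by simp
  ultimately have "int p dvd int (y i) - int (z i) \<or> int p dvd int v - int w"
    by (simp add: prime_dvd_mult_iff)
  moreover have "\<not> int p dvd int (y i) - int (z i)"
    using assms(3-5) zdvd_not_zless[of "\<bar>int (y i) - int (z i)\<bar>" "int p"] by auto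
  ultimately have "int p dvd int v - int w" by blast
  moreover have "\<bar>int v - int w\<bar> < int p" using assms(6,7) by linarith
  ultimately show ?thesis using zdvd_not_zless[of "\<bar>int v - int w\<bar>" "int p"] by auto
qed

text \<open>On average over the entry at \<open>i\<close> the potential does not grow. If
  \<open>y\<close> and \<open>z\<close> differ below \<open>i\<close>, it is 1 before and after. If
  they also agree at \<open>i\<close>, that entry does not affect whether they collide. If they
  first differ at \<open>i\<close>, at most one of the \<open>p\<close> values collides and
  contributes \<open>p\<close>, against a right-hand side of \<open>p * 1\<close>.\<close>

lemma sum_pot_upd_le:
  assumes "prime p" "i < n" "y i < p" "z i < p"
  shows "(\<Sum>v<p. pot n p i (a(i := v)) y z) \<le> p * pot n p (Suc i) a y z"
proof -
  consider "\<not> agree i y z" | "agree i y z" "y i = z i" | "agree i y z" "y i \<noteq> z i" by blast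
  then show ?thesis
  proof cases
    case 1
    then have "\<not> agree (Suc i) y z" unfolding agree_def using less_SucI by blast
    with 1 show ?thesis by (simp add: pot_def collide_def)
  next
    case 2
    then have ag: "agree (Suc i) y z" by (auto simp: agree_def less_Suc_eq)
    have "collide n p i (a(i := v)) y z = collide n p (Suc i) a y z" for v
    proof -
      have "ip n u a = u i * a i + (\<Sum>j\<in>{..<n} - {i}. u j * a j)" for u
        using ip_upd[OF assms(2), of u a "a i"] by simp
      then show ?thesis
        using 2 ag by (simp add: collide_def ip_upd[OF assms(2)] cong_add_lcancel_nat)
    qed
    then show ?thesis using 2 ag by (simp add: pot_def)
  next
    case 3
    then have nag: "\<not> agree (Suc i) y z" by (auto simp: agree_def)
    let ?A = "{v. v < p \<and> collide n p i (a(i := v)) y z}"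
    have "v = w" if "v \<in> ?A" "w \<in> ?A" for v w
      using collide_upd_unique[of p i n y z v w a] assms 3 that by blast
    then have "card ?A \<le> 1"
      by (simp add: card_le_Suc0_iff_eq)
    moreover have "(\<Sum>v<p. pot n p i (a(i := v)) y z) = p * card ?A"
    proof -
      have "(\<Sum>v<p. pot n p i (a(i := v)) y z)
          = p * (\<Sum>v<p. of_bool (collide n p i (a(i := v)) y z))"
        using 3 by (simp add: pot_def sum_distrib_left)
      also have "(\<Sum>v<p. of_bool (collide n p i (a(i := v)) y z)) = card ?A"
        by (simp add: of_bool_def sum.If_cases Int_def)
      finally show ?thesis .
    qed
    ultimately show ?thesis using nag by (simp add: pot_def collide_def)
  qed
qed

text \<open>The term with the zero vector does not depend on \<open>z\<close> and is thus counted
  \<open>card S\<close> times; this yields the combination \<open>2 * M + s * N\<close>.\<close>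

definition wsum :: "nat vec set \<Rightarrow> ((nat \<Rightarrow> nat) \<Rightarrow> (nat \<Rightarrow> nat) \<Rightarrow> nat) \<Rightarrow> nat" where
  "wsum S g = (\<Sum>y\<in>S. \<Sum>z\<in>S. 2 * g (coord y) (coord z) + g (coord y) (\<lambda>_. 0))"

definition cost :: "nat \<Rightarrow> nat \<Rightarrow> nat vec set \<Rightarrow> nat \<Rightarrow> (nat \<Rightarrow> nat) \<Rightarrow> nat" where
  "cost n p S i a = wsum S (\<lambda>y z. of_bool (collide n p i a y z))"

lemma cost_cong:
  assumes "\<And>j. j < n \<Longrightarrow> a j = b j"
  shows "cost n p S i a = cost n p S i b"
proof -
  have "ip n y a = ip n y b" for y unfolding ip_def using assms by (intro sum.cong) auto
  then show ?thesis unfolding cost_def collide_def by simp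
qed

text \<open>The second summand does not depend on \<open>a\<close>, so minimising
  \<open>cost\<close>, which the program can compute, minimises the potential.\<close>

lemma wsum_pot:
  "wsum S (pot n p i a) = p * cost n p S i a + wsum S (\<lambda>y z. of_bool (\<not> agree i y z))"
  unfolding wsum_def cost_def pot_def
  by (simp add: sum.distrib sum_distrib_left algebra_simps)

lemma wsum_pot_cong:
  "(\<And>j. j < n \<Longrightarrow> a j = b j) \<Longrightarrow> wsum S (pot n p i a) = wsum S (pot n p i b)"
  unfolding wsum_pot using cost_cong[of n a b p S i] by simp

text \<open>The minimum over the \<open>p\<close> candidates is at most their average, which
  \<open>sum_pot_upd_le\<close> bounds pair by pair.\<close>

lemma wsum_pot_step:
  assumes "prime p" "i < n" "\<And>y. y \<in> S \<Longrightarrow> coord y i < p"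
    and "\<And>v. v < p \<Longrightarrow> cost n p S i (a(i := b)) \<le> cost n p S i (a(i := v))"
  shows "wsum S (pot n p i (a(i := b))) \<le> wsum S (pot n p (Suc i) a)"
proof -
  have "p * wsum S (pot n p i (a(i := b))) = (\<Sum>v<p. wsum S (pot n p i (a(i := b))))" by simp
  also have "\<dots> \<le> (\<Sum>v<p. wsum S (pot n p i (a(i := v))))"
    using assms(4) by (intro sum_mono) (simp add: wsum_pot)
  also have "\<dots> = wsum S (\<lambda>y z. \<Sum>v<p. pot n p i (a(i := v)) y z)"
  proof -
    have "(\<Sum>v<p. wsum S (pot n p i (a(i := v)))) = (\<Sum>y\<in>S. \<Sum>v<p. \<Sum>z\<in>S.
        2 * pot n p i (a(i := v)) (coord y) (coord z) + pot n p i (a(i := v)) (coord y) (\<lambda>_. 0))"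
      unfolding wsum_def by (rule sum.swap)
    also have "\<dots> = (\<Sum>y\<in>S. \<Sum>z\<in>S. \<Sum>v<p.
        2 * pot n p i (a(i := v)) (coord y) (coord z) + pot n p i (a(i := v)) (coord y) (\<lambda>_. 0))"
      by (intro sum.cong refl sum.swap)
    finally show ?thesis unfolding wsum_def by (simp add: sum.distrib sum_distrib_left)
  qed
  also have "\<dots> \<le> wsum S (\<lambda>y z. p * pot n p (Suc i) a y z)"
    unfolding wsum_def using assms prime_gt_0_nat
    by (intro sum_mono add_mono mult_left_mono sum_pot_upd_le) auto
  also have "\<dots> = p * wsum S (pot n p (Suc i) a)"
    unfolding wsum_def by (simp add: sum_distrib_left algebra_simps)
  finally show ?thesis using prime_gt_0_nat[OF assms(1)] by simp
qed

lemma coord_eq_iff: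
  assumes "y \<in> carrier_vec n" "z \<in> carrier_vec n"
  shows "agree n (coord y) (coord z) \<longleftrightarrow> y = z"
  using assms by (auto simp: agree_def coord_def)

lemma coord_zero: "coord (0\<^sub>v n) = (\<lambda>_. 0)"
  by (auto simp: coord_def)

lemma sum_diagonal:
  fixes b c :: nat
  assumes "finite S" "x \<in> S"
  shows "(\<Sum>z\<in>S. if x = z then b else c) = b + (card S - 1) * c"
proof -
  have "(\<Sum>z\<in>S. if x = z then b else c) = b + (\<Sum>z\<in>S - {x}. if x = z then b else c)"
    using assms by (subst sum.remove) auto
  also have "(\<Sum>z\<in>S - {x}. if x = z then b else c) = (\<Sum>z\<in>S - {x}. c)"
    by (rule sum.cong) auto
  finally show ?thesis using assms by simp
qed

text \<open>Agreeing below \<open>n\<close> means being equal, so before any choice the potential is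
  \<open>p\<close> on the diagonal and 1 off it, whatever \<open>a\<close> is.\<close>

lemma wsum_pot_init:
  assumes "finite S" "S \<subseteq> carrier_vec n" "0\<^sub>v n \<in> S"
  shows "wsum S (pot n p n a) = 3 * card S * (p + (card S - 1))"
proof -
  have pt: "pot n p n a (coord y) (coord z) = (if y = z then p else 1)" if "y \<in> S" "z \<in> S" for y z
    using that assms(2) by (auto simp: pot_def collide_def coord_eq_iff subset_iff)
  have "wsum S (pot n p n a)
      = (\<Sum>y\<in>S. \<Sum>z\<in>S. 2 * (if y = z then p else 1) + (if 0\<^sub>v n = y then p else 1))"
    \<comment> \<open>Since the zero vector lies in \<open>S\<close>, the terms for zeros are also
      potentials of pairs from \<open>S\<close>.\<close>
    unfolding wsum_def coord_zero[of n, symmetric]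
    using assms(3) by (intro sum.cong refl) (auto simp: pt)
  also have "\<dots> = 2 * (\<Sum>y\<in>S. \<Sum>z\<in>S. if y = z then p else 1)
      + card S * (\<Sum>y\<in>S. if 0\<^sub>v n = y then p else 1)"
    by (simp add: sum.distrib sum_distrib_left)
  also have "\<dots> = 2 * (card S * (p + (card S - 1))) + card S * (p + (card S - 1))"
    using assms by (simp add: sum_diagonal)
  finally show ?thesis by simp
qed

section \<open>From a small potential to the two properties\<close>

text \<open>Cauchy--Schwarz for the fibre sizes of \<open>h\<close>: they sum to
  \<open>card S\<close>, and their squares sum to the number of pairs with equal values.\<close>

lemma card_square_le:
  fixes h :: "'a \<Rightarrow> 'b"
  assumes "finite S"
  shows "card S ^ 2 \<le> card (h ` S) * (\<Sum>y\<in>S. \<Sum>z\<in>S. of_bool (h y = h z))"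
proof -
  let ?c = "\<lambda>u. card {y \<in> S. h y = u}"
  have c: "card S = (\<Sum>u\<in>h ` S. ?c u)"
    using sum.image_gen[OF assms, of "\<lambda>_. 1::nat" h] by simp
  have "(\<Sum>y\<in>S. \<Sum>z\<in>S. of_bool (h y = h z)) = (\<Sum>y\<in>S. ?c (h y))"
  proof (rule sum.cong)
    fix y
    have "{z \<in> S. h y = h z} = {z \<in> S. h z = h y}" by auto
    then show "(\<Sum>z\<in>S. of_bool (h y = h z)) = ?c (h y)"
      using assms by (simp add: of_bool_def sum.If_cases Int_def)
  qed simp
  also have "\<dots> = (\<Sum>u\<in>h ` S. \<Sum>y | y \<in> S \<and> h y = u. ?c (h y))"
    by (rule sum.image_gen[OF assms])
  also have "\<dots> = (\<Sum>u\<in>h ` S. ?c u ^ 2)"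
    by (intro sum.cong refl) (simp add: power2_eq_square)
  finally have s: "(\<Sum>y\<in>S. \<Sum>z\<in>S. of_bool (h y = h z)) = (\<Sum>u\<in>h ` S. ?c u ^ 2)" .
  have "2 * (?c u * ?c v) \<le> ?c u ^ 2 + ?c v ^ 2" for u v
    using sum_squares_bound[of "real (?c u)" "real (?c v)"]
    by (simp add: flip: of_nat_le_iff[where 'a = real])
  then have "(\<Sum>u\<in>h ` S. \<Sum>v\<in>h ` S. 2 * (?c u * ?c v))
      \<le> (\<Sum>u\<in>h ` S. \<Sum>v\<in>h ` S. ?c u ^ 2 + ?c v ^ 2)"
    by (intro sum_mono)
  also have "\<dots> = 2 * (card (h ` S) * (\<Sum>u\<in>h ` S. ?c u ^ 2))"
    by (simp add: sum.distrib flip: sum_distrib_left)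
  also have "(\<Sum>u\<in>h ` S. \<Sum>v\<in>h ` S. 2 * (?c u * ?c v)) = 2 * card S ^ 2"
    unfolding c power2_eq_square sum_product by (simp add: sum_distrib_left)
  finally show ?thesis unfolding s by simp
qed

text \<open>In the application \<open>h\<close> is the residue of the scalar product and
  \<open>z0\<close> the zero vector.\<close>

lemma small_cost_imp:
  assumes "finite S" "z0 \<in> S" and ks: "1000 < card S" "card S < p" "3 * p < 4 * card S"
    and h0: "h z0 = 0"
    and le: "p * (\<Sum>y\<in>S. \<Sum>z\<in>S. 2 * of_bool (h y = h z) + of_bool (h y = 0))
      \<le> 3 * card S * (p + (card S - 1))"
  shows "card {y \<in> S. h y = (0::nat)} \<le> 6" "p + 2 \<le> 3 * card (h ` S)"
proof -
  define s where "s = card S"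
  define N where "N = card {y \<in> S. h y = 0}"
  define M where "M = (\<Sum>y\<in>S. \<Sum>z\<in>S. of_bool (h y = h z) :: nat)"
  define m where "m = card (h ` S)"
  have sp: "0 < s" "0 < p" using ks unfolding s_def by auto
  have "(\<Sum>y\<in>S. \<Sum>z\<in>S. 2 * of_bool (h y = h z) + of_bool (h y = 0)) = 2 * M + s * N"
    unfolding M_def N_def s_def using assms(1)
    by (simp add: sum.distrib sum_distrib_left[symmetric] of_bool_def sum.If_cases Int_def)
  with le have le: "p * (2 * M + s * N) \<le> 3 * s * (p + (s - 1))" unfolding s_def by simp
  have "M \<ge> (\<Sum>y\<in>S. \<Sum>z\<in>S. if y = z then 1 else 0)"
    unfolding M_def by (intro sum_mono) auto
  then have Ms: "M \<ge> s" using assms(1) unfolding s_def by (simp add: sum_diagonal)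
  have "{z0} \<subseteq> {y \<in> S. h y = 0}" using assms by auto
  then have N1: "N \<ge> 1" unfolding N_def using card_mono[of "{y \<in> S. h y = 0}" "{z0}"] assms(1) by simp
  show "N \<le> 6"
  proof (rule ccontr)
    assume "\<not> N \<le> 6"
    \<comment> \<open>Seven zeros would force \<open>2 * M + s * N\<close> up to
      \<open>9 * s\<close>, whereas \<open>le\<close> and \<open>s - 1 \<le> p\<close> allow at most
      \<open>6 * s\<close>.\<close>
    then have "s * 7 \<le> s * N" by simp
    with Ms have "9 * s \<le> 2 * M + s * N" by linarith
    then have "p * (9 * s) \<le> p * (2 * M + s * N)" by simp
    also note le
    also have "3 * s * (p + (s - 1)) \<le> 3 * s * (2 * p)"
      using ks unfolding s_def by (intro mult_left_mono) auto
    finally show False using sp by simp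
  qed
  show "p + 2 \<le> 3 * m"
  proof (rule ccontr)
    assume "\<not> p + 2 \<le> 3 * m"
    then have m: "3 * m \<le> p + 1" by simp
    \<comment> \<open>The zero at \<open>z0\<close> accounts for \<open>p * s\<close> on the left of
      \<open>le\<close>; removing it gives the bound \<open>a\<close> on \<open>M\<close>.\<close>
    have "s * 1 \<le> s * N" using N1 by (intro mult_left_mono) auto
    then have "p * (2 * M + s) \<le> p * (2 * M + s * N)" by (intro mult_left_mono) auto
    also note le
    finally have "2 * p * M + p * s \<le> 3 * s * (p + (s - 1))" by (simp only: distrib_left mult.assoc mult.left_commute[of p 2])
    then have "2 * p * M + p * s \<le> 3 * s * p + 3 * s * (s - 1)" by (simp add: algebra_simps)
    then have a: "2 * p * M \<le> s * (2 * p + 3 * (s - 1))" by (simp add: algebra_simps)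
    have "s ^ 2 \<le> m * M" using card_square_le[OF assms(1), of h] unfolding s_def m_def M_def .
    then have "2 * p * s ^ 2 \<le> 2 * p * (m * M)" by simp
    also have "\<dots> = m * (2 * p * M)" by simp
    also have "\<dots> \<le> m * (s * (2 * p + 3 * (s - 1)))" using a by (intro mult_left_mono) auto
    finally have "s * (2 * p * s) \<le> s * (m * (2 * p + 3 * (s - 1)))"
      by (simp add: power2_eq_square algebra_simps)
    then have "2 * p * s \<le> m * (2 * p + 3 * (s - 1))" using sp by simp
    then have "3 * (2 * p * s) \<le> (3 * m) * (2 * p + 3 * (s - 1))" by simp
    also have "\<dots> \<le> (p + 1) * (2 * p + 3 * (s - 1))" using m by (intro mult_right_mono) auto
    finally have "real (3 * (2 * p * s)) \<le> real ((p + 1) * (2 * p + 3 * (s - 1)))"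
      by (simp only: of_nat_le_iff)
    then have b: "6 * real p * real s \<le> (real p + 1) * (2 * real p + 3 * (real s - 1))"
      using sp(1) by (simp add: of_nat_diff Suc_leI mult.assoc distrib_right)
    have s: "3 * real p \<le> 4 * real s" "1000 < real s" "1000 < real p"
      using ks unfolding s_def by auto
    \<comment> \<open>The bound \<open>b\<close> rearranges to
      \<open>3 * s * (p - 1) \<le> 2 * p ^ 2 - p - 3\<close>. Multiplying by 4 and using
      \<open>3 * p \<le> 4 * s\<close> leaves \<open>p ^ 2 \<le> 5 * p\<close>, which is impossible
      for \<open>p > 1000\<close>.\<close>
    have "3 * (3 * real p) * (real p - 1) \<le> 3 * (4 * real s) * (real p - 1)"
      using s by (intro mult_right_mono mult_left_mono) auto
    with b have "9 * real p * (real p - 1) \<le> 8 * real p * real p - 4 * real p"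
      by (simp add: algebra_simps)
    then have "real p * real p \<le> real p * 5" by (simp add: algebra_simps)
    with s show False by simp
  qed
qed

section \<open>The program\<close>

text \<open>
  Registers: 0 and 1 hold \<open>n\<close> and \<open>p\<close>, 2 the constant 1, 3 the stage \<open>i\<close>, 4 the candidate
  value of \<open>a i\<close>, 5 and 6 the best candidate so far and its cost, 7 the cost of the current
  candidate, 8 an index \<open>j\<close>; 13 to 18 are scratch.  The cells \<open>0, \<dots>, n - 1\<close> hold \<open>a\<close> and the cells
  \<open>n, \<dots>, 2 * n - 1\<close> hold the element \<open>y\<close> of the outer one of the two loops over \<open>S\<close>.
  Of the accumulators 9 to 12, 9 and 11 vanish if and only if \<open>y\<close> agrees below \<open>i\<close> with \<open>z\<close> and
  with \<open>0\<close>; 10 and 12 contain the scalar products of \<open>y - z\<close> and \<open>y\<close> with \<open>a\<close>.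
\<close>

definition coord_step :: com where
  "coord_step = block
    [Arith 8 Sub 8 2, Arith 13 Add 0 8, Load 13 13, Coord 14 8, Load 15 8, Arith 16 Sub 3 8,
     Arith 17 Mul 16 13, Arith 11 Add 11 17,
     Arith 17 Mul 13 15, Arith 12 Add 12 17,
     Arith 17 Sub 1 14, Arith 17 Add 13 17, Arith 17 Mul 17 15, Arith 10 Add 10 17,
     Arith 17 Sub 13 14, Arith 18 Sub 14 13, Arith 17 Add 17 18, Arith 17 Mul 16 17,
     Arith 9 Add 9 17]"

text \<open>Multiplication by the 1 in register 2 copies a register. Truncated subtraction from 1
  turns an accumulator into a 0/1 test; the first test is added twice, for the factor 2 in
  \<open>wsum\<close>.\<close>

definition pair_step :: com where
  "pair_step = Seq
    (block [Const 9 0, Const 10 0, Const 11 0, Const 12 0, Arith 8 Mul 0 2])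
    (Seq (WhileNZ 8 coord_step)
    (block [Arith 10 Mod 10 1, Arith 9 Add 9 10, Arith 9 Sub 2 9, Arith 7 Add 7 9, Arith 7 Add 7 9,
      Arith 12 Mod 12 1, Arith 11 Add 11 12, Arith 11 Sub 2 11, Arith 7 Add 7 11]))"

text \<open>\<open>Coord\<close> sees only the element of the innermost loop, so \<open>y\<close> is
  saved in memory before the inner loop starts.\<close>

definition element_step :: com where
  "element_step = Seq (block [Arith 8 Mul 0 2])
    (Seq (WhileNZ 8 (block [Arith 8 Sub 8 2, Arith 13 Add 0 8, Coord 14 8, Store 13 14]))
    (ForEach pair_step))"

text \<open>Candidates run from \<open>p - 1\<close> down to 0. The truncated difference in register
  13 is nonzero exactly if the current candidate is strictly better than the best so far.\<close>

definition candidate_step :: com where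
  "candidate_step = Seq (block [Arith 4 Sub 4 2, Store 3 4, Const 7 0])
    (Seq (ForEach element_step)
    (Seq (block [Arith 13 Sub 6 7])
    (IfNZ 13 (block [Arith 6 Mul 7 2, Arith 5 Mul 4 2]) (block [Const 13 0]))))"

text \<open>The initial best cost \<open>3 * p * p\<close> exceeds every possible cost, so the first
  candidate is always accepted.\<close>

definition stage :: com where
  "stage = Seq
    (block [Arith 3 Sub 3 2, Const 5 0, Const 13 3, Arith 6 Mul 1 1, Arith 6 Mul 13 6, Arith 4 Mul 1 2])
    (Seq (WhileNZ 4 candidate_step)
    (block [Store 3 5]))"

definition derandomize :: com where
  "derandomize = Seq (block [Const 2 1, Arith 3 Mul 0 2]) (WhileNZ 3 stage)"

section \<open>Arithmetic tests for agreement and collision\<close>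

lemma one_minus_eq_of_bool: "1 - (m::nat) = of_bool (m = 0)"
  by (cases m) auto

text \<open>The truncated factor \<open>i - j\<close> vanishes for \<open>j \<ge> i\<close>, so the
  sum may run over all coordinates without branching; the two truncated differences add up to the
  absolute difference.\<close>

lemma agree_iff_sum_diff:
  assumes "i \<le> n"
  shows "(\<Sum>j<n. (i - j) * ((y j - z j) + (z j - y j))) = 0 \<longleftrightarrow> agree i y z"
proof -
  have "(i - j) * ((y j - z j) + (z j - y j)) = 0 \<longleftrightarrow> (j < i \<longrightarrow> y j = z j)" for j
    by auto
  with assms show ?thesis by (auto simp only: agree_def sum_eq_0_iff finite_lessThan lessThan_iff)
qed

text \<open>As \<open>z j \<le> p\<close>, the factor \<open>y j + (p - z j)\<close> is a natural
  number congruent to \<open>y j - z j\<close>, so the second sum represents the difference of the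
  two scalar products.\<close>

lemma collide_test:
  assumes "i \<le> n" "\<And>j. z j \<le> p"
  shows "1 - ((\<Sum>j<n. (i - j) * ((y j - z j) + (z j - y j)))
    + (\<Sum>j<n. (y j + (p - z j)) * a j) mod p) = of_bool (collide n p i a y z)"
proof -
  have "(y j + (p - z j)) * a j + z j * a j = y j * a j + p * a j" for j
    using assms(2)[of j] by (simp flip: distrib_right)
  then have "(\<Sum>j<n. (y j + (p - z j)) * a j) + ip n z a = (\<Sum>j<n. y j * a j + p * a j)"
    unfolding ip_def sum.distrib[symmetric] by simp
  then have eq: "(\<Sum>j<n. (y j + (p - z j)) * a j) + ip n z a = ip n y a + p * (\<Sum>j<n. a j)"
    by (simp add: ip_def sum.distrib sum_distrib_left)
  have "(\<Sum>j<n. (y j + (p - z j)) * a j) mod p = 0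
      \<longleftrightarrow> [(\<Sum>j<n. (y j + (p - z j)) * a j) + ip n z a = 0 + ip n z a] (mod p)"
    by (simp only: cong_add_rcancel_nat) (simp add: cong_def)
  also have "\<dots> \<longleftrightarrow> [ip n y a = ip n z a] (mod p)"
    unfolding eq by (simp add: cong_def)
  finally show ?thesis
    unfolding one_minus_eq_of_bool collide_def agree_iff_sum_diff[OF assms(1), of y z, symmetric]
    by simp
qed

lemma collide_zero_test:
  assumes "i \<le> n"
  shows "1 - ((\<Sum>j<n. (i - j) * y j) + (\<Sum>j<n. y j * a j) mod p)
    = of_bool (collide n p i a y (\<lambda>_. 0))"
  using agree_iff_sum_diff[OF assms, of y "\<lambda>_. 0"]
  unfolding one_minus_eq_of_bool collide_def ip_def by (simp add: cong_def)

section \<open>Correctness and running time of the loops, from the innermost outwards\<close>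

locale derandomization =
  fixes n p :: nat and S :: "nat vec set" and xs :: "nat vec list"
  assumes n_pos: "1 \<le> n" and prime_p: "prime p" and S_sub: "S \<subseteq> Zp_vecs n p"
    and zero_in_S: "0\<^sub>v n \<in> S" and card_less: "card S < p"
    and set_xs: "set xs = S" and distinct_xs: "distinct xs"
begin

text \<open>This dominates every intermediate value: the agreement sums, of order
  \<open>n * n * p\<close>, the unreduced scalar products, of order \<open>n * p * p\<close>, and
  the costs, below \<open>3 * p * p\<close>. Its logarithm is still small enough for the space
  bound.\<close>

definition B :: nat where "B = 8 * (n * n * (p * p))"

sublocale machine xs 19 "2 * n" B .

lemma p_pos: "1 \<le> p"
  using prime_gt_0_nat[OF prime_p] by simp

lemma le_B:
  "m \<le> 8 * (n * (n * p)) \<Longrightarrow> m \<le> B" "m \<le> 8 * (n * (p * p)) \<Longrightarrow> m \<le> B"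
  "m \<le> 8 * (p * p) \<Longrightarrow> m \<le> B" "m \<le> 8 * n \<Longrightarrow> m \<le> B" "m \<le> 8 * p \<Longrightarrow> m \<le> B" "m \<le> 8 \<Longrightarrow> m \<le> B"
proof -
  have *: "m \<le> B" if "m \<le> 8 * (u * v)" "u \<le> n * n" "v \<le> p * p" for m u v
    using that(1) mult_le_mono[OF that(2,3)] unfolding B_def by linarith
  have nn: "n \<le> n * n" "1 \<le> n * n" and pp: "p \<le> p * p" "1 \<le> p * p"
    using n_pos p_pos by auto
  show "m \<le> 8 * (n * (n * p)) \<Longrightarrow> m \<le> B" using *[of m "n * n" p] pp by (simp add: mult.assoc)
  show "m \<le> 8 * (n * (p * p)) \<Longrightarrow> m \<le> B" using *[of m n "p * p"] nn by simp
  show "m \<le> 8 * (p * p) \<Longrightarrow> m \<le> B" using *[of m 1 "p * p"] nn by simp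
  show "m \<le> 8 * n \<Longrightarrow> m \<le> B" using *[of m n 1] nn pp by simp
  show "m \<le> 8 * p \<Longrightarrow> m \<le> B" using *[of m 1 p] nn pp by simp
  show "m \<le> 8 \<Longrightarrow> m \<le> B" using *[of m 1 1] nn pp by simp
qed

lemma coord_less: "z \<in> S \<Longrightarrow> coord z j < p"
  using S_sub p_pos by (auto simp: coord_def Zp_vecs_def subset_iff)

lemma length_xs: "length xs = card S"
  using distinct_card[OF distinct_xs] set_xs by simp

lemma sum_le:
  assumes "\<And>j. f j \<le> c" shows "(\<Sum>j\<in>{k..<n}. f j) \<le> n * (c::nat)"
proof -
  have "(\<Sum>j\<in>{k..<n}. f j) \<le> of_nat (card {k..<n}) * c"
    by (rule sum_bounded_above) (use assms in auto)
  also have "\<dots> \<le> n * c" by simp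
  finally show ?thesis .
qed

text \<open>The index counts down, so the accumulators hold the sums over \<open>{k..<n}\<close>.
  The final bounds on registers 9 and 11 are exported because \<open>pair_step\<close> goes on to
  add residues to them.\<close>

lemma wp_coord_loop:
  assumes s: "reg s 0 = n" "reg s 1 = p" "reg s 2 = 1" "reg s 3 = i" "i \<le> n" "reg s 8 = n"
    "reg s 9 = 0" "reg s 10 = 0" "reg s 11 = 0" "reg s 12 = 0"
    and a: "\<And>j. j < n \<Longrightarrow> mem s j = a j" "\<And>j. a j < p"
    and y: "\<And>j. j < n \<Longrightarrow> mem s (n + j) = y j" "\<And>j. y j < p"
    and z: "\<And>j. coord z j < p"
  shows "wp z (WhileNZ 8 coord_step) (1 + n * 20) 0 (\<lambda>s'.
    (\<forall>r<8. reg s' r = reg s r) \<and> mem s' = mem s \<and>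
    reg s' 9 = (\<Sum>j<n. (i - j) * ((y j - coord z j) + (coord z j - y j))) \<and>
    reg s' 10 = (\<Sum>j<n. (y j + (p - coord z j)) * a j) \<and>
    reg s' 11 = (\<Sum>j<n. (i - j) * y j) \<and> reg s' 12 = (\<Sum>j<n. y j * a j) \<and>
    reg s' 9 \<le> n * (n * (2 * p)) \<and> reg s' 11 \<le> n * (n * p)) s"
proof -
  define f9 where "f9 j = (i - j) * ((y j - coord z j) + (coord z j - y j))" for j
  define f10 where "f10 j = (y j + (p - coord z j)) * a j" for j
  define f11 where "f11 j = (i - j) * y j" for j
  define f12 where "f12 j = y j * a j" for j
  let ?I = "\<lambda>k (s' :: state). (\<forall>r<8. reg s' r = reg s r) \<and> mem s' = mem s \<and>
    reg s' 9 = sum f9 {k..<n} \<and> reg s' 10 = sum f10 {k..<n} \<and>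
    reg s' 11 = sum f11 {k..<n} \<and> reg s' 12 = sum f12 {k..<n}"
  note [simp] = less_imp_le[OF z] less_imp_le[OF y(2)] less_imp_le[OF a(2)]
  have i: "i - j \<le> n" for j using s(5) by simp
  have "f9 j \<le> n * (2 * p)" for j
    unfolding f9_def using z[of j] y(2)[of j] by (intro mult_le_mono i) simp
  moreover have "f10 j \<le> (2 * p) * p" for j
    unfolding f10_def using y(2)[of j] by (intro mult_le_mono) simp_all
  moreover have "f11 j \<le> n * p" for j
    unfolding f11_def by (intro mult_le_mono i) simp
  moreover have "f12 j \<le> p * p" for j
    unfolding f12_def by (intro mult_le_mono) simp_all
  ultimately have les: "sum f9 {k..<n} \<le> n * (n * (2 * p))" "sum f10 {k..<n} \<le> n * ((2 * p) * p)"
    "sum f11 {k..<n} \<le> n * (n * p)" "sum f12 {k..<n} \<le> n * (p * p)" for k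
    by (blast intro: sum_le)+
  moreover have "n * (n * (2 * p)) \<le> B" "n * (n * p) \<le> B"
    by (rule le_B(1), simp)+
  moreover have "n * ((2 * p) * p) \<le> B" "n * (p * p) \<le> B"
    by (rule le_B(2), simp)+
  ultimately have le: "sum f9 {k..<n} \<le> B" "sum f10 {k..<n} \<le> B" "sum f11 {k..<n} \<le> B"
    "sum f12 {k..<n} \<le> B" for k
    by (meson order_trans)+
  have "wp z (WhileNZ 8 coord_step) (1 + n * 20) 0 (?I 0) s"
  proof (rule wp_while[where N = n and t = 19 and q = 0])
    fix k and s' :: state assume k: "k < n" "reg s' 8 = Suc k" and I: "?I (Suc k) s'"
    have split: "sum f {k..<n} = f k + sum f {Suc k..<n}" for f :: "nat \<Rightarrow> nat"
      using k(1) by (rule sum.atLeast_Suc_lessThan)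
    note les = le[of k, unfolded split]
    have regs: "reg s' 0 = n" "reg s' (Suc 0) = p" "reg s' 2 = 1" "reg s' 3 = i"
      using I s by auto
    have small: "n + k \<le> B" "coord z k \<le> B" "i - k \<le> B" "p \<le> B"
      "y k + (p - coord z k) \<le> B" "y k - coord z k \<le> B" "coord z k - y k \<le> B"
      "y k - coord z k + (coord z k - y k) \<le> B" "k \<le> B"
      using k(1) i[of k] z[of k] y(2)[of k] by (auto intro: le_B(4,5))
    show "wp z coord_step 19 0 (\<lambda>s''. reg s'' 8 = k \<and> ?I k s'') s'"
      unfolding coord_step_def
      by (rule wp_block)
        (use k I les small in \<open>simp_all add: regs a(1) y(1) split f9_def[of k] f10_def[of k]
          f11_def[of k] f12_def[of k] diff_le_self[THEN order_trans]\<close>)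
  qed (use s in auto)
  then show ?thesis
    by (rule wp_mono)
      (use les(1,3)[of 0] in \<open>auto simp: f9_def f10_def f11_def f12_def lessThan_atLeast0\<close>)
qed

text \<open>One pair adds at most 3, whence the slack of 3 per pair demanded of register 7
  below.\<close>

definition weight :: "nat \<Rightarrow> (nat \<Rightarrow> nat) \<Rightarrow> (nat \<Rightarrow> nat) \<Rightarrow> nat vec \<Rightarrow> nat" where
  "weight i a y z = 2 * of_bool (collide n p i a y (coord z)) + of_bool (collide n p i a y (\<lambda>_. 0))"

lemma wp_pair_step:
  assumes s: "reg s 0 = n" "reg s 1 = p" "reg s 2 = 1" "reg s 3 = i" "i \<le> n" "reg s 7 + 3 \<le> B"
    and a: "\<And>j. j < n \<Longrightarrow> mem s j = a j" "\<And>j. a j < p"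
    and y: "\<And>j. j < n \<Longrightarrow> mem s (n + j) = y j" "\<And>j. y j < p"
    and z: "\<And>j. coord z j < p"
  shows "wp z pair_step (35 * n) 0 (\<lambda>s'. (\<forall>r<7. reg s' r = reg s r) \<and> mem s' = mem s \<and>
    reg s' 7 = reg s 7 + weight i a y z) s"
  unfolding pair_step_def
proof (rule wp_seq)
  let ?s = "s\<lparr>reg := (reg s)(9 := 0, 10 := 0, 11 := 0, 12 := 0, 8 := n)\<rparr>"
  show "wp z (block [Const 9 0, Const 10 0, Const 11 0, Const 12 0, Arith 8 Mul 0 2]) 5 0
      (\<lambda>s'. s' = ?s) s"
    by (rule wp_block) (use s n_pos p_pos le_B(4)[of n] in auto)
  fix s' assume s': "s' = ?s"
  let ?end = "block [Arith 10 Mod 10 1, Arith 9 Add 9 10, Arith 9 Sub 2 9, Arith 7 Add 7 9,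
    Arith 7 Add 7 9, Arith 12 Mod 12 1, Arith 11 Add 11 12, Arith 11 Sub 2 11, Arith 7 Add 7 11]"
  show "wp z (Seq (WhileNZ 8 coord_step) ?end) (10 + n * 20) 0
    (\<lambda>s'. (\<forall>r<7. reg s' r = reg s r) \<and> mem s' = mem s \<and> reg s' 7 = reg s 7 + weight i a y z) s'"
  proof (rule wp_seq)
    show "wp z (WhileNZ 8 coord_step) (1 + n * 20) 0 (\<lambda>s''.
      (\<forall>r<8. reg s'' r = reg s' r) \<and> mem s'' = mem s' \<and>
      reg s'' 9 = (\<Sum>j<n. (i - j) * ((y j - coord z j) + (coord z j - y j))) \<and>
      reg s'' 10 = (\<Sum>j<n. (y j + (p - coord z j)) * a j) \<and>
      reg s'' 11 = (\<Sum>j<n. (i - j) * y j) \<and> reg s'' 12 = (\<Sum>j<n. y j * a j) \<and>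
      reg s'' 9 \<le> n * (n * (2 * p)) \<and> reg s'' 11 \<le> n * (n * p)) s'"
      by (rule wp_coord_loop) (use assms in \<open>auto simp: s'\<close>)
  next
    fix u :: state assume u: "(\<forall>r<8. reg u r = reg s' r) \<and> mem u = mem s' \<and>
      reg u 9 = (\<Sum>j<n. (i - j) * ((y j - coord z j) + (coord z j - y j))) \<and>
      reg u 10 = (\<Sum>j<n. (y j + (p - coord z j)) * a j) \<and>
      reg u 11 = (\<Sum>j<n. (i - j) * y j) \<and> reg u 12 = (\<Sum>j<n. y j * a j) \<and>
      reg u 9 \<le> n * (n * (2 * p)) \<and> reg u 11 \<le> n * (n * p)"
    have pn: "p \<le> n * (n * p)" using n_pos by simp
    have m: "m mod p \<le> p" for m using p_pos by (simp add: less_imp_le)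
    have small: "reg u 10 mod p \<le> B" "reg u 12 mod p \<le> B"
      using m[of "reg u 10"] m[of "reg u 12"] by (auto intro: le_B(5))
    have small2: "reg u 9 + reg u 10 mod p \<le> B" "reg u 11 + reg u 12 mod p \<le> B"
      by (rule le_B(1), use u pn m[of "reg u 10"] in linarith,
          rule le_B(1), use u pn m[of "reg u 12"] in linarith)
    have "1 \<le> B" by (rule le_B) simp
    have test: "1 - (reg u 9 + reg u 10 mod p) = of_bool (collide n p i a y (coord z))"
      "1 - (reg u 11 + reg u 12 mod p) = of_bool (collide n p i a y (\<lambda>_. 0))"
      using u collide_test[of i n "coord z" p y a] collide_zero_test[of i n y a p] s(5) z
      by (simp_all add: less_imp_le)
    have regs: "reg u (Suc 0) = p" "reg u 2 = 1" "reg u 7 = reg s 7"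
      "\<forall>r<7. reg u r = reg s r" "mem u = mem s"
      using u s by (auto simp: s')
    have of_bool_le: "of_bool b \<le> (1::nat)" for b by simp
    show "wp z ?end 9 0 (\<lambda>s'. (\<forall>r<7. reg s' r = reg s r) \<and> mem s' = mem s \<and>
        reg s' 7 = reg s 7 + weight i a y z) u"
      by (rule wp_block)
        (use small small2 s(6) \<open>1 \<le> B\<close> in
          \<open>simp_all add: regs test[unfolded One_nat_def] weight_def split: split_of_bool\<close>)
  qed auto
qed (use n_pos in auto)

text \<open>The saved copy of \<open>y\<close> overwrites the cells from \<open>n\<close> on, so
  only the cells of \<open>a\<close> are claimed to survive. From here on, lower-order terms of the
  running time are absorbed into the constant using \<open>n, p \<ge> 1\<close>.\<close>

lemma wp_element_step:
  assumes s: "reg s 0 = n" "reg s 1 = p" "reg s 2 = 1" "reg s 3 = i" "i \<le> n"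
      "reg s 7 + 3 * length xs \<le> B"
    and a: "\<And>j. j < n \<Longrightarrow> mem s j = a j" "\<And>j. a j < p"
    and y: "y \<in> S"
  shows "wp y element_step (44 * (n * p)) 1 (\<lambda>s'. (\<forall>r<7. reg s' r = reg s r) \<and>
    (\<forall>j<n. mem s' j = a j) \<and> reg s' 7 = reg s 7 + (\<Sum>z\<leftarrow>xs. weight i a (coord y) z)) s"
    (is "wp _ _ _ _ ?Q s")
  unfolding element_step_def
proof (rule wp_seq)
  let ?s = "s\<lparr>reg := (reg s)(8 := n)\<rparr>"
  show "wp y (block [Arith 8 Mul 0 2]) 1 0 (\<lambda>s'. s' = ?s) s"
    by (rule wp_block) (use s n_pos p_pos le_B(4)[of n] in auto)
  fix s' assume s': "s' = ?s"
  let ?copy = "block [Arith 8 Sub 8 2, Arith 13 Add 0 8, Coord 14 8, Store 13 14]"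
  let ?I = "\<lambda>k (u :: state). (\<forall>r<8. reg u r = reg s r) \<and> (\<forall>j<n. mem u j = a j) \<and>
    (\<forall>j<n. k \<le> j \<longrightarrow> mem u (n + j) = coord y j)"
  show "wp y (Seq (WhileNZ 8 ?copy) (ForEach pair_step)) (1 + n * 5 + (1 + length xs * (1 + 35 * n)))
    1 ?Q s'"
  proof (rule wp_seq)
    show "wp y (WhileNZ 8 ?copy) (1 + n * 5) 0 (?I 0) s'"
    proof (rule wp_while[where N = n and t = 4 and q = 0])
      fix k and u :: state assume k: "k < n" "reg u 8 = Suc k" and I: "?I (Suc k) u"
      have small: "n + k \<le> B" "coord y k \<le> B" "k \<le> B"
        using k(1) coord_less[OF y, of k] by (auto intro: le_B(4,5))
      have regs: "reg u 0 = n" "reg u 2 = 1" using I s by auto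
      show "wp y ?copy 4 0 (\<lambda>u. reg u 8 = k \<and> ?I k u) u"
      proof (rule wp_block)
        show "reg (fold (effect y) [Arith 8 Sub 8 2, Arith 13 Add 0 8, Coord 14 8, Store 13 14] u) 8 = k
          \<and> ?I k (fold (effect y) [Arith 8 Sub 8 2, Arith 13 Add 0 8, Coord 14 8, Store 13 14] u)"
          using k I by (auto simp: regs)
      qed (use k small in \<open>simp_all add: regs\<close>)
    qed (use s a in \<open>auto simp: s'\<close>)
  next
    fix v :: state assume v: "?I 0 v"
    let ?J = "\<lambda>zs (u :: state). (\<forall>r<7. reg u r = reg s r) \<and> mem u = mem v \<and>
      reg u 7 = reg s 7 + (\<Sum>z\<leftarrow>zs. weight i a (coord y) z)"
    have "wp y (ForEach pair_step) (1 + length xs * (1 + 35 * n)) 1 (?J xs) v"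
    proof (rule wp_foreach[where t = "35 * n" and q = 0])
      fix ys z zs and u :: state assume xs: "xs = ys @ z # zs" and J: "?J ys u"
      have "z \<in> S" using xs set_xs by auto
      have "(\<Sum>z\<leftarrow>ys. weight i a (coord y) z) \<le> (\<Sum>z\<leftarrow>ys. 3)"
        by (rule sum_list_mono) (simp add: weight_def)
      then have "reg u 7 + 3 \<le> B" using J s(6) xs by (simp add: sum_list_triv)
      then have "wp z pair_step (35 * n) 0 (\<lambda>s'. (\<forall>r<7. reg s' r = reg u r) \<and> mem s' = mem u \<and>
          reg s' 7 = reg u 7 + weight i a (coord y) z) u"
        by (intro wp_pair_step) (use J s a v y \<open>z \<in> S\<close> coord_less in auto)
      then show "wp z pair_step (35 * n) 0 (?J (ys @ [z])) u"
        by (rule wp_mono) (use J in auto)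
    qed (use v in auto)
    then show "wp y (ForEach pair_step) (1 + length xs * (1 + 35 * n)) 1 ?Q v"
      by (rule wp_mono) (use v in auto)
  qed auto
next
  have "length xs * (1 + 35 * n) \<le> p * (36 * n)"
    using card_less length_xs n_pos by (intro mult_le_mono) auto
  then have "length xs * (1 + 35 * n) \<le> 36 * (n * p)" by (simp only: ac_simps)
  moreover have "n \<le> n * p" "1 \<le> n * p" using n_pos p_pos by auto
  ultimately show "1 + (1 + n * 5 + (1 + length xs * (1 + 35 * n))) \<le> 44 * (n * p)"
    by linarith
qed auto

text \<open>Distinctness of \<open>xs\<close> turns the sums over the enumeration into the sums over
  \<open>S\<close> in \<open>cost\<close>.\<close>

lemma sum_weight: "(\<Sum>y\<leftarrow>xs. \<Sum>z\<leftarrow>xs. weight i a (coord y) z) = cost n p S i a"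
  by (simp add: sum_list_distinct_conv_sum_set[OF distinct_xs] set_xs cost_def wsum_def weight_def)

text \<open>The outer loop is one iteration over \<open>S\<close> and each of its elements starts
  another; \<open>1 + card S \<le> p\<close>.\<close>

lemma wp_cost_loop:
  assumes s: "reg s 0 = n" "reg s 1 = p" "reg s 2 = 1" "reg s 3 = i" "i \<le> n" "reg s 7 = 0"
    and a: "\<And>j. j < n \<Longrightarrow> mem s j = a j" "\<And>j. a j < p"
  shows "wp x (ForEach element_step) (46 * (n * (p * p))) p (\<lambda>s'. (\<forall>r<7. reg s' r = reg s r) \<and>
    (\<forall>j<n. mem s' j = a j) \<and> reg s' 7 = cost n p S i a) s"
proof -
  let ?J = "\<lambda>ys (u :: state). (\<forall>r<7. reg u r = reg s r) \<and> (\<forall>j<n. mem u j = a j) \<and>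
    reg u 7 = (\<Sum>y\<leftarrow>ys. \<Sum>z\<leftarrow>xs. weight i a (coord y) z)"
  have "wp x (ForEach element_step) (46 * (n * (p * p))) p (?J xs) s"
  proof (rule wp_foreach[where I = ?J and t = "44 * (n * p)" and q = 1])
    fix ys y zs and u :: state assume xs: "xs = ys @ y # zs" and J: "?J ys u"
    have "y \<in> S" using xs set_xs by auto
    have "(\<Sum>z\<leftarrow>xs. weight i a (coord y) z) \<le> (\<Sum>z\<leftarrow>xs. 3)" for y
      by (rule sum_list_mono) (simp add: weight_def)
    then have "(\<Sum>y\<leftarrow>ys. \<Sum>z\<leftarrow>xs. weight i a (coord y) z) \<le> (\<Sum>y\<leftarrow>ys. 3 * length xs)"
      by (intro sum_list_mono) (simp add: sum_list_triv mult.commute)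
    then have "reg u 7 + 3 * length xs \<le> (length ys + 1) * (3 * length xs)"
      using J by (simp add: sum_list_triv)
    \<comment> \<open>The element \<open>y\<close> is still to come, so
      \<open>length ys + 1 \<le> length xs\<close>.\<close>
    also have "\<dots> \<le> p * (3 * p)"
      using card_less length_xs xs by (intro mult_le_mono) auto
    finally have "reg u 7 + 3 * length xs \<le> B" by (intro le_B(3)) simp
    then have "wp y element_step (44 * (n * p)) 1 (\<lambda>s'. (\<forall>r<7. reg s' r = reg u r) \<and>
        (\<forall>j<n. mem s' j = a j) \<and> reg s' 7 = reg u 7 + (\<Sum>z\<leftarrow>xs. weight i a (coord y) z)) u"
      by (intro wp_element_step) (use J s a \<open>y \<in> S\<close> in auto)
    then show "wp y element_step (44 * (n * p)) 1 (?J (ys @ [y])) u"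
      by (rule wp_mono) (use J in auto)
  next
    have "length xs * (1 + 44 * (n * p)) \<le> p * (45 * (n * p))"
      using card_less length_xs n_pos p_pos by (intro mult_le_mono) auto
    then have "length xs * (1 + 44 * (n * p)) \<le> 45 * (n * (p * p))" by (simp only: ac_simps)
    moreover have "1 \<le> n * (p * p)" using n_pos p_pos by auto
    ultimately show "1 + length xs * (1 + 44 * (n * p)) \<le> 46 * (n * (p * p))"
      by linarith
  qed (use s a card_less length_xs in auto)
  then show ?thesis by (rule wp_mono) (auto simp: sum_weight)
qed

lemma wp_candidate_loop:
  assumes s: "reg s 0 = n" "reg s 1 = p" "reg s 2 = 1" "reg s 3 = i" "i < n" "reg s 4 = p"
      "reg s 5 = 0" "reg s 6 = 3 * (p * p)"
    and a: "\<And>j. j < n \<Longrightarrow> mem s j = a j" "\<And>j. a j < p"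
  shows "wp x (WhileNZ 4 candidate_step) (55 * (n * (p * (p * p)))) (p * p) (\<lambda>s'.
    (\<forall>r<4. reg s' r = reg s r) \<and> (\<forall>j<n. j \<noteq> i \<longrightarrow> mem s' j = a j) \<and> reg s' 5 < p \<and>
    (\<forall>v<p. cost n p S i (a(i := reg s' 5)) \<le> cost n p S i (a(i := v)))) s"
proof -
  let ?c = "\<lambda>v. cost n p S i (a(i := v))"
  \<comment> \<open>The candidates from \<open>k\<close> on have been tried. For
    \<open>k = p\<close> there are none: register 5 is a placeholder and register 6 the initial
    value, which is not the cost of any candidate.\<close>
  let ?I = "\<lambda>k (u :: state). (\<forall>r<4. reg u r = reg s r) \<and> (\<forall>j<n. j \<noteq> i \<longrightarrow> mem u j = a j) \<and>
    reg u 5 < p \<and> (\<forall>v. k \<le> v \<longrightarrow> v < p \<longrightarrow> reg u 6 \<le> ?c v) \<and>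
    (k < p \<longrightarrow> reg u 6 = ?c (reg u 5)) \<and> (k = p \<longrightarrow> reg u 6 = 3 * (p * p))"
  have cost_less: "cost n p S i b < 3 * (p * p)" for b
  proof -
    have "(\<Sum>y\<leftarrow>xs. \<Sum>z\<leftarrow>xs. weight i b (coord y) z) \<le> (\<Sum>y\<leftarrow>xs. \<Sum>z\<leftarrow>xs. 3)"
      by (intro sum_list_mono) (simp add: weight_def)
    then have "cost n p S i b \<le> 3 * (length xs * length xs)"
      by (simp add: sum_weight sum_list_triv)
    also have "\<dots> < 3 * (p * p)"
      using card_less length_xs by (simp add: mult_strict_mono)
    finally show ?thesis .
  qed
  have "wp x (WhileNZ 4 candidate_step) (55 * (n * (p * (p * p)))) (p * p) (?I 0) s"
  proof (rule wp_while[where N = p and I = ?I and t = "53 * (n * (p * p))" and q = p])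
    fix k and u :: state
    assume k: "k < p" "reg u 4 = Suc k" and I: "?I (Suc k) u"
    have regs: "reg u 0 = n" "reg u (Suc 0) = p" "reg u 2 = 1" "reg u 3 = i" using I s by auto
    let ?b = "a(i := k)"
    let ?u = "u\<lparr>reg := (reg u)(4 := k, 7 := 0), mem := (mem u)(i := k)\<rparr>"
    have k_le: "k \<le> B" using k(1) by (intro le_B(5)) simp
    show "wp x candidate_step (53 * (n * (p * p))) p (\<lambda>u. reg u 4 = k \<and> ?I k u) u"
      unfolding candidate_step_def
    proof (rule wp_seq)
      show "wp x (block [Arith 4 Sub 4 2, Store 3 4, Const 7 0]) 3 0 (\<lambda>u'. u' = ?u) u"
        by (rule wp_block) (use k k_le s(5) in \<open>simp_all add: regs fun_upd_twist\<close>)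
    next
      fix u' :: state assume u': "u' = ?u"
      let ?update = "IfNZ 13 (block [Arith 6 Mul 7 2, Arith 5 Mul 4 2]) (block [Const 13 0])"
      show "wp x (Seq (ForEach element_step) (Seq (block [Arith 13 Sub 6 7]) ?update))
        (46 * (n * (p * p)) + 4) p (\<lambda>u. reg u 4 = k \<and> ?I k u) u'"
      proof (rule wp_seq)
        show "wp x (ForEach element_step) (46 * (n * (p * p))) p (\<lambda>s'.
          (\<forall>r<7. reg s' r = reg u' r) \<and> (\<forall>j<n. mem s' j = ?b j) \<and> reg s' 7 = ?c k) u'"
          by (rule wp_cost_loop) (use I s a k in \<open>auto simp: u'\<close>)
      next
        fix w :: state assume w: "(\<forall>r<7. reg w r = reg u' r) \<and> (\<forall>j<n. mem w j = ?b j) \<and> reg w 7 = ?c k"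
        have wr: "reg w 4 = k" "reg w 5 = reg u 5" "reg w 6 = reg u 6" "reg w 2 = 1"
          "\<forall>r<4. reg w r = reg s r" "\<forall>j<n. j \<noteq> i \<longrightarrow> mem w j = a j"
          using w I s by (auto simp: u')
        let ?w = "w\<lparr>reg := (reg w)(13 := reg u 6 - ?c k)\<rparr>"
        show "wp x (Seq (block [Arith 13 Sub 6 7]) ?update) 4 0 (\<lambda>u. reg u 4 = k \<and> ?I k u) w"
        proof (rule wp_seq)
          show "wp x (block [Arith 13 Sub 6 7]) 1 0 (\<lambda>w'. w' = ?w) w"
          proof (rule wp_block)
            assume "ok w"
            then have "reg w 6 - m \<le> B" for m
              unfolding ok_def by (meson diff_le_self order_trans)
            then show "all_fit x [Arith 13 Sub 6 7] w" by simp
          qed (use w wr in auto)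
        next
          fix w' :: state assume w': "w' = ?w"
          show "wp x ?update 3 0 (\<lambda>u. reg u 4 = k \<and> ?I k u) w'"
          proof (rule wp_if)
            assume "reg w' 13 \<noteq> 0"
            then have less: "?c k < reg u 6" by (simp add: w')
            have c_le: "?c k \<le> B" using cost_less[of ?b] by (intro le_B(3)) simp
            have bounds: "v = k \<or> ?c k \<le> ?c v" if "k \<le> v" "v < p" for v
              using that I less by (metis Suc_leI le_neq_implies_less less_imp_le order_trans)
            show "wp x (block [Arith 6 Mul 7 2, Arith 5 Mul 4 2]) 2 0
                (\<lambda>u. reg u 4 = k \<and> ?I k u) w'"
              by (rule wp_block) (use w wr k c_le k_le bounds in \<open>auto simp: w'\<close>)
          next
            assume "reg w' 13 = 0"
            then have le: "reg u 6 \<le> ?c k" by (simp add: w')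
            \<comment> \<open>The first candidate cannot be rejected, so register 6 already holds
              the cost of register 5.\<close>
            then have "Suc k \<noteq> p" using I cost_less[of ?b] by auto
            moreover have "reg u 6 \<le> ?c v" if "k \<le> v" "v < p" for v
              using that I le by (metis Suc_leI le_neq_implies_less)
            ultimately show "wp x (block [Const 13 0]) 2 0 (\<lambda>u. reg u 4 = k \<and> ?I k u) w'"
              by (intro wp_block) (use w wr k I in \<open>auto simp: w'\<close>)
          qed auto
        qed auto
      qed auto
    next
      have "1 \<le> n * (p * p)" using n_pos p_pos by auto
      then show "3 + (46 * (n * (p * p)) + 4) \<le> 53 * (n * (p * p))" by linarith
    qed auto
  next
    have "p * (1 + 53 * (n * (p * p))) \<le> p * (54 * (n * (p * p)))"
      using n_pos p_pos by (intro mult_le_mono) auto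
    then have "p * (1 + 53 * (n * (p * p))) \<le> 54 * (n * (p * (p * p)))" by (simp only: ac_simps)
    moreover have "1 \<le> n * (p * (p * p))" using n_pos p_pos by auto
    ultimately show "1 + p * (1 + 53 * (n * (p * p))) \<le> 55 * (n * (p * (p * p)))" by linarith
  qed (use s a p_pos in auto)
  then show ?thesis by (rule wp_mono) (use p_pos in auto)
qed

text \<open>The invariant is that the potential never exceeds its initial value. At stage 0,
  \<open>wsum_pot\<close> turns this into the bound on the cost.\<close>

lemma wp_stage_loop:
  assumes s: "reg s 0 = n" "reg s 1 = p" "reg s 2 = 1" "reg s 3 = n" "\<And>j. mem s j = 0"
  shows "wp x (WhileNZ 3 stage) (64 * (n * (n * (p * (p * p))))) (n * (p * p)) (\<lambda>s'.
    (\<forall>j<n. mem s' j < p) \<and> p * cost n p S 0 (mem s') \<le> 3 * card S * (p + (card S - 1))) s"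
proof -
  let ?I = "\<lambda>k (u :: state). (\<forall>r<3. reg u r = reg s r) \<and> (\<forall>j<n. mem u j < p) \<and>
    wsum S (pot n p k (mem u)) \<le> 3 * card S * (p + (card S - 1))"
  have "wp x (WhileNZ 3 stage) (64 * (n * (n * (p * (p * p))))) (n * (p * p)) (?I 0) s"
  proof (rule wp_while[where N = n and I = ?I and t = "62 * (n * (p * (p * p)))" and q = "p * p"])
    fix k and u :: state
    assume k: "k < n" "reg u 3 = Suc k" and I: "?I (Suc k) u"
    have regs: "reg u 0 = n" "reg u (Suc 0) = p" "reg u 2 = 1" using I s by auto
    let ?u = "u\<lparr>reg := (reg u)(3 := k, 5 := 0, 13 := 3, 6 := 3 * (p * p), 4 := p)\<rparr>"
    have small: "k \<le> B" "3 \<le> B" "p * p \<le> B" "3 * (p * p) \<le> B" "p \<le> B"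
      using k(1) by (auto intro: le_B(3-6))
    \<comment> \<open>The cells from \<open>n\<close> on hold leftovers of elements of
      \<open>S\<close>; cutting them off makes all values of \<open>a\<close> less than
      \<open>p\<close>, and the potential ignores them.\<close>
    define a where "a j = (if j < n then mem u j else 0)" for j
    show "wp x stage (62 * (n * (p * (p * p)))) (p * p) (\<lambda>u. reg u 3 = k \<and> ?I k u) u"
      unfolding stage_def
    proof (rule wp_seq)
      show "wp x (block [Arith 3 Sub 3 2, Const 5 0, Const 13 3, Arith 6 Mul 1 1, Arith 6 Mul 13 6,
          Arith 4 Mul 1 2]) 6 0 (\<lambda>u'. u' = ?u) u"
        by (rule wp_block) (use k small in \<open>simp_all add: regs\<close>)
    next
      fix u' :: state assume u': "u' = ?u"
      show "wp x (Seq (WhileNZ 4 candidate_step) (block [Store 3 5]))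
        (55 * (n * (p * (p * p))) + 1) (p * p) (\<lambda>u. reg u 3 = k \<and> ?I k u) u'"
      proof (rule wp_seq)
        show "wp x (WhileNZ 4 candidate_step) (55 * (n * (p * (p * p)))) (p * p) (\<lambda>s'.
          (\<forall>r<4. reg s' r = reg u' r) \<and> (\<forall>j<n. j \<noteq> k \<longrightarrow> mem s' j = a j) \<and> reg s' 5 < p \<and>
          (\<forall>v<p. cost n p S k (a(k := reg s' 5)) \<le> cost n p S k (a(k := v)))) u'"
          by (rule wp_candidate_loop) (use I regs k p_pos in \<open>auto simp: u' a_def\<close>)
      next
        fix w :: state
        assume w: "(\<forall>r<4. reg w r = reg u' r) \<and> (\<forall>j<n. j \<noteq> k \<longrightarrow> mem w j = a j) \<and> reg w 5 < p \<and>
          (\<forall>v<p. cost n p S k (a(k := reg w 5)) \<le> cost n p S k (a(k := v)))"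
        have wr: "reg w 3 = k" "\<forall>r<3. reg w r = reg s r" using w I by (auto simp: u')
        have "wsum S (pot n p k ((mem w)(k := reg w 5))) = wsum S (pot n p k (a(k := reg w 5)))"
          by (rule wsum_pot_cong) (use w in auto)
        also have "\<dots> \<le> wsum S (pot n p (Suc k) a)"
          by (rule wsum_pot_step[OF prime_p k(1)]) (use w coord_less in auto)
        also have "\<dots> = wsum S (pot n p (Suc k) (mem u))"
          by (rule wsum_pot_cong) (simp add: a_def)
        also have "\<dots> \<le> 3 * card S * (p + (card S - 1))" using I by blast
        finally have W: "wsum S (pot n p k ((mem w)(k := reg w 5)))
          \<le> 3 * card S * (p + (card S - 1))" .
        have "\<forall>j<n. ((mem w)(k := reg w 5)) j < p" using w I by (auto simp: a_def)
        with W show "wp x (block [Store 3 5]) 1 0 (\<lambda>u. reg u 3 = k \<and> ?I k u) w"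
          by (intro wp_block) (use wr k in \<open>auto simp del: fun_upd_apply\<close>)
      qed auto
    next
      have "1 \<le> n * (p * (p * p))" using n_pos p_pos by auto
      then show "6 + (55 * (n * (p * (p * p))) + 1) \<le> 62 * (n * (p * (p * p)))" by linarith
    qed auto
  next
    have "S \<subseteq> carrier_vec n" using S_sub by (auto simp: Zp_vecs_def)
    then show "?I n s"
      using wsum_pot_init[of S n p "mem s"] set_xs zero_in_S s p_pos by auto
  next
    have "n * (1 + 62 * (n * (p * (p * p)))) \<le> n * (63 * (n * (p * (p * p))))"
      using n_pos p_pos by (intro mult_le_mono) auto
    then have "n * (1 + 62 * (n * (p * (p * p)))) \<le> 63 * (n * (n * (p * (p * p))))"
      by (simp only: ac_simps)
    moreover have "1 \<le> n * (n * (p * (p * p)))" using n_pos p_pos by auto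
    ultimately show "1 + n * (1 + 62 * (n * (p * (p * p)))) \<le> 64 * (n * (n * (p * (p * p))))"
      by linarith
  qed (use s in auto)
  then show ?thesis by (rule wp_mono) (auto simp: wsum_pot)
qed

lemma wp_derandomize:
  "wp x derandomize (66 * (n * (n * (p * (p * p))))) (n * (p * p)) (\<lambda>s'.
    (\<forall>j<n. mem s' j < p) \<and> p * cost n p S 0 (mem s') \<le> 3 * card S * (p + (card S - 1))) (init n p)"
    (is "wp _ _ _ _ ?Q _")
  unfolding derandomize_def
proof (rule wp_seq)
  let ?s = "(init n p)\<lparr>reg := (reg (init n p))(2 := 1, 3 := n)\<rparr>"
  show "wp x (block [Const 2 1, Arith 3 Mul 0 2]) 2 0 (\<lambda>s. s = ?s) (init n p)"
    by (rule wp_block) (use le_B(4)[of n] le_B(6)[of 1] in \<open>simp_all add: init_def\<close>)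
  show "wp x (WhileNZ 3 stage) (64 * (n * (n * (p * (p * p))))) (n * (p * p)) ?Q s" if "s = ?s" for s
    by (rule wp_stage_loop) (simp_all add: that init_def)
  have "1 \<le> n * (n * (p * (p * p)))" using n_pos p_pos by auto
  then show "2 + 64 * (n * (n * (p * (p * p)))) \<le> 66 * (n * (n * (p * (p * p))))" by linarith
qed auto

section \<open>From the run of the program to the properties of its output and the space
  bound\<close>

lemma scalar_prod_eq_ip:
  assumes "y \<in> S"
  shows "y \<bullet> vec n f = ip n (coord y) f"
  using assms S_sub
  by (auto simp: scalar_prod_def ip_def coord_def Zp_vecs_def lessThan_atLeast0 intro!: sum.cong)

lemma runs_derandomize:
  assumes "1000 < card S" "3 * p < 4 * card S"
  shows "\<exists>t q m a. runs derandomize n p xs t q m a \<and> a \<in> Zp_vecs n p \<and>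
    card {y \<in> S. [y \<bullet> a = 0] (mod p)} \<le> 6 \<and> p + 2 \<le> 3 * card ((\<lambda>y. (y \<bullet> a) mod p) ` S) \<and>
    t \<le> 66 * (n * (n * (p * (p * p)))) \<and> q \<le> n * (p * p) \<and> m \<le> space_bound"
proof -
  have "ok (init n p)"
    using le_B(4)[of n] le_B(5)[of p] by (auto simp: ok_def init_def)
  with wp_derandomize[of vNil] obtain t q m s where run: "exec xs vNil derandomize (init n p) t q m s"
    "t \<le> 66 * (n * (n * (p * (p * p))))" "q \<le> n * (p * p)" "m \<le> space_bound"
    and s: "\<forall>j<n. mem s j < p" "p * cost n p S 0 (mem s) \<le> 3 * card S * (p + (card S - 1))"
    unfolding wp_def by blast
  define a where "a = result_vec n s"
  define h where "h y = (y \<bullet> a) mod p" for y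
  have h: "h y = ip n (coord y) (mem s) mod p" if "y \<in> S" for y
    using scalar_prod_eq_ip[OF that] by (simp add: h_def a_def result_vec_def)
  have h0: "h (0\<^sub>v n) = 0"
    by (simp add: h[OF zero_in_S] ip_def coord_zero)
  \<comment> \<open>Agreement below 0 is vacuous, so at stage 0 colliding just means having equal
    residues.\<close>
  have "cost n p S 0 (mem s) = (\<Sum>y\<in>S. \<Sum>z\<in>S. 2 * of_bool (h y = h z) + of_bool (h y = 0))"
    unfolding cost_def wsum_def
    by (intro sum.cong refl) (simp add: h collide_def agree_def cong_def ip_def)
  with s(2) have le: "p * (\<Sum>y\<in>S. \<Sum>z\<in>S. 2 * of_bool (h y = h z) + of_bool (h y = 0))
      \<le> 3 * card S * (p + (card S - 1))" by simp
  have "finite S" using set_xs by auto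
  note result = small_cost_imp[OF this zero_in_S assms(1) card_less assms(2) h0 le]
  have "a \<in> Zp_vecs n p" using s(1) by (auto simp: a_def result_vec_def Zp_vecs_def)
  moreover have "{y \<in> S. [y \<bullet> a = 0] (mod p)} = {y \<in> S. h y = 0}"
    by (simp add: h_def cong_def)
  moreover have "(\<lambda>y. (y \<bullet> a) mod p) ` S = h ` S" by (simp add: h_def)
  moreover have "runs derandomize n p xs t q m a" using run(1) by (auto simp: runs_def a_def)
  ultimately show ?thesis
    using run result by (intro exI[of _ t] exI[of _ q] exI[of _ m] exI[of _ a]) (simp add: h_def)
qed

text \<open>The 19 registers and \<open>2 * n\<close> memory cells have contents of
  \<open>O(log n + log p)\<close> bits; \<open>log 2 n \<le> n\<close> makes this a polynomial in
  \<open>n\<close> and \<open>log 2 p\<close>.\<close>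

lemma space_bound_le:
  "real space_bound \<le> 19 * (24 + 2 * real n + 2 * log 2 (real p))
    + 2 * real n * (5 + 4 * real n + 2 * log 2 (real p))"
proof -
  have fl: "real (floorlog 2 B) \<le> 5 + 2 * real n + 2 * log 2 (real p)"
  proof -
    have "B > 0" using n_pos p_pos by (simp add: B_def)
    then have "real (floorlog 2 B) \<le> log 2 (real B) + 1"
      by (simp add: floorlog_def)
    also have "log 2 (real B) = 3 + 2 * log 2 (real n) + 2 * log 2 (real p)"
    proof -
      have "log 2 8 = (3::real)" using log_pow_cancel[of 2 3] by simp
      then show ?thesis using n_pos p_pos by (simp add: B_def log_mult)
    qed
    also have "log 2 (real n) \<le> real n"
    proof -
      have "real n \<le> 2 powr real n"
        using less_exp[of n] by (simp add: powr_realpow less_imp_le flip: of_nat_power of_nat_le_iff)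
      then show ?thesis using n_pos by (simp add: log_le_iff)
    qed
    finally show ?thesis by simp
  qed
  have "real space_bound = 19 * (19 + real (floorlog 2 B)) + 2 * real n * (2 * real n + real (floorlog 2 B))"
    unfolding space_bound_def by simp
  also have "\<dots> \<le> 19 * (19 + (5 + 2 * real n + 2 * log 2 (real p)))
      + 2 * real n * (2 * real n + (5 + 2 * real n + 2 * log 2 (real p)))"
    using fl by (intro add_mono mult_left_mono) auto
  finally show ?thesis by (simp add: algebra_simps)
qed

end

theorem theorem5p1:
  shows "\<exists>(P :: com) (T :: real poly poly) (C :: real) (M :: real poly poly).
    \<forall>(n :: nat) (p :: nat) (S :: nat vec set) (xs :: nat vec list).
      n \<ge> 1 \<longrightarrow> prime p \<longrightarrow> S \<subseteq> Zp_vecs n p \<longrightarrow> 0\<^sub>v n \<in> S \<longrightarrow>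
      1000 < card S \<longrightarrow> card S < p \<longrightarrow> real p < 4 * real (card S) / 3 \<longrightarrow>
      set xs = S \<longrightarrow> distinct xs \<longrightarrow>
      (\<exists>(t :: nat) (q :: nat) (m :: nat) (a :: nat vec).
        runs P n p xs t q m a \<and>
        a \<in> Zp_vecs n p \<and>
        card {y \<in> S. [y \<bullet> a = 0] (mod p)} \<le> 6 \<and>
        real (card ((\<lambda>y. (y \<bullet> a) mod p) ` S)) \<ge> (real p + 2) / 3 \<and>
        real t \<le> poly_n_logp T n p * real p ^ 4 \<and>
        real q \<le> C * real n * real p ^ 3 \<and>
        real m \<le> poly_n_logp M n p)"
\<comment> \<open>The outer variable of the polynomials is \<open>n\<close>. The witnesses are
  \<open>66 * n ^ 2\<close> and the expansion of \<open>space_bound_le\<close>, grouped by powers of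
  \<open>n\<close>.\<close>
proof (rule exI[of _ derandomize], rule exI[of _ "[:0, 0, [:66:]:]"], rule exI[of _ 1],
    rule exI[of _ "[:[:456, 38:], [:48, 4:], [:8:]:]"], intro allI impI)
  fix n p S xs
  assume asm: "n \<ge> 1" "prime p" "S \<subseteq> Zp_vecs n p" "0\<^sub>v n \<in> S" "1000 < card S" "card S < p"
    "real p < 4 * real (card S) / 3" "set xs = S" "distinct xs"
  interpret derandomization n p S xs by unfold_locales (use asm in auto)
  have "3 * p < 4 * card S" using asm(7) by linarith
  with runs_derandomize asm(5) obtain t q m a where run: "runs derandomize n p xs t q m a"
    "a \<in> Zp_vecs n p" "card {y \<in> S. [y \<bullet> a = 0] (mod p)} \<le> 6"
    "p + 2 \<le> 3 * card ((\<lambda>y. (y \<bullet> a) mod p) ` S)"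
    "t \<le> 66 * (n * (n * (p * (p * p))))" "q \<le> n * (p * p)" "m \<le> space_bound"
    by blast
  \<comment> \<open>The program takes only \<open>O(n ^ 2 * p ^ 3)\<close> steps and
    \<open>n * p ^ 2\<close> iterations; one spare factor \<open>p\<close> brings each bound into
    the stated form.\<close>
  have "t \<le> 66 * (n * (n * p ^ 4))"
    by (rule order_trans[OF run(5)]) (use p_pos in \<open>simp add: power4_eq_xxxx\<close>)
  then have t: "real t \<le> poly_n_logp [:0, 0, [:66:]:] n p * real p ^ 4"
    unfolding poly_n_logp_def by (simp flip: of_nat_le_iff[where 'a = real] add: algebra_simps)
  have "q \<le> n * p ^ 3"
    by (rule order_trans[OF run(6)]) (use p_pos in \<open>simp add: power3_eq_cube\<close>)
  then have q: "real q \<le> 1 * real n * real p ^ 3"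
    by (simp flip: of_nat_le_iff[where 'a = real])
  have "real m \<le> real space_bound" using run(7) by simp
  also note space_bound_le
  finally have "real m \<le> poly_n_logp [:[:456, 38:], [:48, 4:], [:8:]:] n p"
    unfolding poly_n_logp_def by (simp add: algebra_simps)
  with run t q show "\<exists>t q m a. runs derandomize n p xs t q m a \<and> a \<in> Zp_vecs n p \<and>
      card {y \<in> S. [y \<bullet> a = 0] (mod p)} \<le> 6 \<and>
      real (card ((\<lambda>y. (y \<bullet> a) mod p) ` S)) \<ge> (real p + 2) / 3 \<and>
      real t \<le> poly_n_logp [:0, 0, [:66:]:] n p * real p ^ 4 \<and>
      real q \<le> 1 * real n * real p ^ 3 \<and>
      real m \<le> poly_n_logp [:[:456, 38:], [:48, 4:], [:8:]:] n p"
    by (intro exI[of _ t] exI[of _ q] exI[of _ m] exI[of _ a]) auto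
qed

end
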